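(* Let $m>\tfrac12$ be real. Let $L,M\in\mathbb{C}[X]$ be polynomials with $\deg L=\ell$ and $\deg M<\ell$, such that $L(ik)$ is purely imaginary for every real $k$ (i.e. the operator $L(D)$, $D=\partial/\partial x$, is formally skew-adjoint). Let $G\in\mathbb{C}[X]$ be a polynomial with $G(0)=0$. For $\Delta t>0$ put $d=\Delta t/2$, and let $B$ and $C$ be the operators on $H^m=H^m(\mathbb{S}^1,\mathbb{C})$ $$B=\frac{d\,M(D)}{I-d\,L(D)},\qquad C=\frac{I+d\,L(D)}{I-d\,L(D)},$$ and for $u\in H^m$ define $H_u:H^m\to H^m$ by $$H_u(w)=Cu+B\,[G(u)+G(w)].$$ Let $B_\rho$ denote the closed ball of radius $\rho$ centered at $0$ in $H^m$. Then for every $R>0$ there exist $r>0$, $T>0$ and a constant $K<1$ such that, for all $u\in B_r$ and all $\Delta t$ with $0<\Delta t<T$, the map $H_u$ sends $B_R$ into $B_R$ and is a contraction there with contraction constant $K$: $$\|H_u(w_1)-H_u(w_2)\|_m\le K\,\|w_1-w_2\|_m\qquad\text{for all } w_1,w_2\in B_R.$$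
   Context: Functions on $\mathbb{S}^1$ are identified with $2\pi$-periodic functions of $x\in\mathbb{R}$; $\hat u(k)$, $k\in\mathbb{Z}$, are the Fourier coefficients of $u$ with respect to $e_k(x)=e^{ikx}$. The Sobolev space $H^m=H^m(\mathbb{S}^1,\mathbb{C})$ is the Hilbert space of all $u\in L^2(\mathbb{S}^1,\mathbb{C})$ for which $\|u\|_m^2=\sum_{k\in\mathbb{Z}}(1+k^2)^m|\hat u(k)|^2$ is finite. For a polynomial $G$, $G(u)$ denotes the function $x\mapsto G(u(x))$; since $m>\tfrac12$, this maps $H^m$ to itself. The operators $B$ and $C$, written as rational functions of $D=\partial/\partial x$, are the Fourier multiplier operators that multiply the $k$-th Fourier coefficient ($k\in\mathbb{Z}$) by $$\frac{d\,M(ik)}{1-d\,L(ik)}\qquad\text{and}\qquad\frac{1+d\,L(ik)}{1-d\,L(ik)}$$ respectively; the denominators do not vanish because $L(ik)$ is purely imaginary. Both $B$ and $C$ (and hence $H_u$) depend on $\Delta t$ through $d=\Delta t/2$. *)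

theory Defs
  imports "HOL-Analysis.Analysis" "HOL-Computational_Algebra.Polynomial"
begin

text \<open>
  Elements of \<open>L\<^sup>2\<close> and \<open>H\<^sup>m\<close> are handled through representatives: periodic functions
  that are not identified when they agree almost everywhere. Fourier coefficients and
  Sobolev norms are the same for all representatives of a class.
\<close>

definition L2_circle :: "(real \<Rightarrow> complex) set" where
  "L2_circle = {u. (\<forall>x. u (x + 2 * pi) = u x) \<and> u \<in> borel_measurable lebesgue \<and>
     set_integrable lebesgue {0..2 * pi} (\<lambda>x. (cmod (u x))\<^sup>2)}"

definition fourier_coeff :: "(real \<Rightarrow> complex) \<Rightarrow> int \<Rightarrow> complex" where
  "fourier_coeff u k =
     (LINT x:{0..2 * pi}|lebesgue. u x * exp (- (\<i> * of_int k * of_real x))) / of_real (2 * pi)"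

definition sobolev :: "real \<Rightarrow> (real \<Rightarrow> complex) set" where
  "sobolev m = {u \<in> L2_circle.
     (\<lambda>k. (1 + (of_int k)\<^sup>2) powr m * (cmod (fourier_coeff u k))\<^sup>2) summable_on UNIV}"

definition sobolev_norm :: "real \<Rightarrow> (real \<Rightarrow> complex) \<Rightarrow> real" where
  "sobolev_norm m u =
     sqrt (\<Sum>\<^sub>\<infinity>k\<in>UNIV. (1 + (of_int k)\<^sup>2) powr m * (cmod (fourier_coeff u k))\<^sup>2)"

definition sobolev_ball :: "real \<Rightarrow> real \<Rightarrow> (real \<Rightarrow> complex) set" where
  "sobolev_ball m \<rho> = {u \<in> sobolev m. sobolev_norm m u \<le> \<rho>}"

text \<open>
  An \<open>L\<^sup>2\<close> function is determined almost everywhere by its Fourier coefficients, so the choice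
  below only selects a representative; the result depends only on the class of \<open>u\<close>.
\<close>

definition fourier_multiplier ::
    "(int \<Rightarrow> complex) \<Rightarrow> (real \<Rightarrow> complex) \<Rightarrow> (real \<Rightarrow> complex)" where
  "fourier_multiplier \<sigma> u =
     (SOME v. v \<in> L2_circle \<and> (\<forall>k. fourier_coeff v k = \<sigma> k * fourier_coeff u k))"

definition B_op ::
    "complex poly \<Rightarrow> complex poly \<Rightarrow> real \<Rightarrow> (real \<Rightarrow> complex) \<Rightarrow> (real \<Rightarrow> complex)" where
  "B_op L M \<Delta>t = (let d = complex_of_real (\<Delta>t / 2) in
     fourier_multiplier (\<lambda>k. d * poly M (\<i> * of_int k) / (1 - d * poly L (\<i> * of_int k))))"

definition C_op ::
    "complex poly \<Rightarrow> real \<Rightarrow> (real \<Rightarrow> complex) \<Rightarrow> (real \<Rightarrow> complex)" where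
  "C_op L \<Delta>t = (let d = complex_of_real (\<Delta>t / 2) in
     fourier_multiplier (\<lambda>k. (1 + d * poly L (\<i> * of_int k)) / (1 - d * poly L (\<i> * of_int k))))"

definition H_map ::
    "complex poly \<Rightarrow> complex poly \<Rightarrow> complex poly \<Rightarrow> real \<Rightarrow>
     (real \<Rightarrow> complex) \<Rightarrow> (real \<Rightarrow> complex) \<Rightarrow> (real \<Rightarrow> complex)" where
  "H_map L M G \<Delta>t u w =
     (\<lambda>x. C_op L \<Delta>t u x + B_op L M \<Delta>t (\<lambda>y. poly G (u y) + poly G (w y)) x)"

end

theory Submission imports Defs begin

text \<open>
  Since \<open>m > 1/2\<close>, the coefficients of a function in \<open>H\<^sup>m\<close> are absolutely summable, so the function
  is almost everywhere the sum of its Fourier series, and \<open>H\<^sup>m\<close> is an algebra; hence \<open>w \<mapsto> G(w)\<close> is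
  bounded and Lipschitz on \<open>B\<^sub>R\<close>, with a common constant \<open>K\<close>. The symbol of \<open>C\<close> is unimodular. The
  symbol of \<open>B\<close> tends to \<open>0\<close> uniformly as \<open>\<Delta>t \<rightarrow> 0\<close>: given \<open>\<epsilon>\<close> we have \<open>|M| \<le> \<epsilon>|L| + C\<^sub>\<epsilon>\<close> because
  \<open>deg M < deg L\<close>, while \<open>|1 - d L(ik)|\<close> dominates both \<open>1\<close> and \<open>d|L(ik)|\<close>. So for \<open>r = R/2\<close> and
  \<open>\<parallel>B\<parallel> \<le> \<epsilon>\<close> small the map \<open>H\<^sub>u\<close> preserves \<open>B\<^sub>R\<close> and contracts with constant \<open>\<epsilon> K \<le> 1/2\<close>.
\<close>

section \<open>Uniqueness of Fourier coefficients\<close>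

text \<open>Restricting to one closed period gives a finite measure space, so that set integrals
  become plain integrals and constants and bounded measurable functions are integrable.\<close>

abbreviation circ :: "real measure" where
  "circ \<equiv> lebesgue_on {0..2 * pi}"

definition fourier_mode :: "int \<Rightarrow> real \<Rightarrow> complex" where
  "fourier_mode k x = exp (\<i> * of_int k * of_real x)"

lemma fourier_mode_0 [simp]: "fourier_mode 0 x = 1"
  by (simp add: fourier_mode_def)

lemma fourier_mode_add: "fourier_mode (j + k) x = fourier_mode j x * fourier_mode k x"
  by (simp add: fourier_mode_def exp_add [symmetric] algebra_simps)

lemma norm_fourier_mode [simp]: "norm (fourier_mode k x) = 1"
  by (simp add: fourier_mode_def)

lemma fourier_mode_periodic [simp]: "fourier_mode k (x + 2 * pi) = fourier_mode k x"
proof -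
  have "\<i> * of_int k * of_real (x + 2 * pi) = \<i> * of_int k * of_real x + 2 * of_int k * pi * \<i>"
    by (simp add: algebra_simps)
  then show ?thesis
    unfolding fourier_mode_def by (simp only: exp_add exp_integer_2pi Ints_of_int) simp
qed

lemma continuous_on_fourier_mode [continuous_intros]: "continuous_on S (fourier_mode k)"
  unfolding fourier_mode_def by (intro continuous_intros)

lemma continuous_measurable_circ:
  fixes f :: "real \<Rightarrow> 'a::euclidean_space"
  assumes "continuous_on {0..2 * pi} f"
  shows "f \<in> borel_measurable circ"
  using assms by (rule continuous_imp_measurable_on_sets_lebesgue) simp

lemma fourier_mode_measurable [measurable]: "fourier_mode k \<in> borel_measurable circ"
  by (intro continuous_measurable_circ continuous_intros)

interpretation circ: finite_measure circ
  by (rule finite_measure_lebesgue_on) simp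

lemma measure_circ [simp]: "measure circ {0..2 * pi} = 2 * pi"
  by (subst measure_restrict_space) auto

lemma set_integrable_circ:
  fixes f :: "real \<Rightarrow> 'a::{banach, second_countable_topology}"
  shows "set_integrable lebesgue {0..2 * pi} f \<longleftrightarrow> integrable circ f"
  by (simp add: set_integrable_def integrable_restrict_space)

lemma set_integral_circ:
  fixes f :: "real \<Rightarrow> 'a::{banach, second_countable_topology}"
  shows "(LINT x:{0..2 * pi}|lebesgue. f x) = (LINT x|circ. f x)"
  by (simp add: set_lebesgue_integral_def integral_restrict_space)

lemma fourier_coeff_circ:
  "fourier_coeff u k = (LINT x|circ. u x * fourier_mode (- k) x) / of_real (2 * pi)"
  by (simp add: fourier_coeff_def set_integral_circ fourier_mode_def)

lemma integrable_circ_mult_bounded: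
  fixes f g :: "real \<Rightarrow> complex"
  assumes "integrable circ f" "g \<in> borel_measurable circ" "AE x in circ. norm (g x) \<le> B"
  shows "integrable circ (\<lambda>x. f x * g x)"
proof (rule Bochner_Integration.integrable_bound)
  show "integrable circ (\<lambda>x. B * norm (f x))"
    using assms(1) by simp
  show "(\<lambda>x. f x * g x) \<in> borel_measurable circ"
    using assms by measurable
  show "AE x in circ. norm (f x * g x) \<le> norm (B * norm (f x))"
    using assms(3)
  proof eventually_elim
    case (elim x)
    have "norm (f x) * norm (g x) \<le> norm (f x) * \<bar>B\<bar>"
      using elim by (intro mult_left_mono) auto
    then show ?case by (simp add: norm_mult abs_mult mult.commute)
  qed
qed

lemma integrable_circ_mult_mode [simp]:
  "integrable circ f \<Longrightarrow> integrable circ (\<lambda>x. f x * fourier_mode k x)"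
  by (rule integrable_circ_mult_bounded [where B = 1]) auto

lemma integrable_circ_const [simp]: "integrable circ (\<lambda>x. a :: 'a::{banach, second_countable_topology})"
  by (rule circ.integrable_const)

section \<open>Algebraic rules and bounds for Fourier coefficients\<close>

lemma fourier_coeff_add:
  assumes "integrable circ f" "integrable circ g"
  shows "fourier_coeff (\<lambda>x. f x + g x) k = fourier_coeff f k + fourier_coeff g k"
  using assms by (simp add: fourier_coeff_circ distrib_right add_divide_distrib)

lemma fourier_coeff_diff:
  assumes "integrable circ f" "integrable circ g"
  shows "fourier_coeff (\<lambda>x. f x - g x) k = fourier_coeff f k - fourier_coeff g k"
  using assms by (simp add: fourier_coeff_circ left_diff_distrib diff_divide_distrib)

lemma fourier_coeff_cmult: "fourier_coeff (\<lambda>x. a * f x) k = a * fourier_coeff f k"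
  by (simp add: fourier_coeff_circ mult.assoc)

lemma fourier_coeff_mult_mode:
  "fourier_coeff (\<lambda>x. f x * fourier_mode j x) k = fourier_coeff f (k - j)"
  by (simp add: fourier_coeff_circ mult.assoc flip: fourier_mode_add)

lemma fourier_coeff_sum_modes:
  assumes "integrable circ f"
  shows "fourier_coeff (\<lambda>x. \<Sum>j\<in>F. c j * fourier_mode j x * f x) k
    = (\<Sum>j\<in>F. c j * fourier_coeff f (k - j))"
proof (induction F rule: infinite_finite_induct)
  case (insert j F)
  have i: "integrable circ (\<lambda>x. c i * fourier_mode i x * f x)" for i
    using integrable_mult_right [OF integrable_circ_mult_mode [OF assms, of i], of "c i"]
    by (simp add: ac_simps)
  have "fourier_coeff (\<lambda>x. c j * fourier_mode j x * f x) k = c j * fourier_coeff f (k - j)"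
    using fourier_coeff_cmult [of "c j" "\<lambda>x. f x * fourier_mode j x"]
    by (simp add: fourier_coeff_mult_mode ac_simps)
  then show ?case
    using insert i by (simp add: fourier_coeff_add)
qed (auto simp: fourier_coeff_circ)

lemma norm_fourier_coeff_le:
  assumes "integrable circ f"
  shows "norm (fourier_coeff f k) \<le> (LINT x|circ. norm (f x)) / (2 * pi)"
proof -
  have "norm (LINT x|circ. f x * fourier_mode (- k) x) \<le> (LINT x|circ. norm (f x * fourier_mode (- k) x))"
    by (rule integral_norm_bound)
  then show ?thesis
    by (simp add: fourier_coeff_circ norm_divide norm_mult divide_right_mono)
qed

lemma fourier_coeff_cong_AE:
  assumes "f \<in> borel_measurable circ" "g \<in> borel_measurable circ" "AE x in circ. f x = g x"
  shows "fourier_coeff f k = fourier_coeff g k"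
proof -
  have "(LINT x|circ. f x * fourier_mode (- k) x) = (LINT x|circ. g x * fourier_mode (- k) x)"
    by (rule integral_cong_AE) (use assms in \<open>auto elim: eventually_mono\<close>)
  then show ?thesis by (simp add: fourier_coeff_circ)
qed

lemma fourier_coeff_one: "fourier_coeff (\<lambda>x. 1) k = (if k = 0 then 1 else 0)"
proof (cases "k = 0")
  case True
  then show ?thesis by (simp add: fourier_coeff_circ scaleR_conv_of_real)
next
  case False
  have c: "continuous_on {0..2 * pi} (fourier_mode (- k))"
    by (intro continuous_intros)
  \<comment> \<open>An antiderivative of the mode, available because \<open>k\<close> is nonzero; by
    periodicity it takes the same value at both ends, so the integral vanishes.\<close>
  define g where "g = (\<lambda>x. fourier_mode (- k) x / (- \<i> * of_int k))"
  have "((\<lambda>x. fourier_mode (- k) x) has_integral g (2 * pi) - g 0) {0..2 * pi}"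
  proof (rule fundamental_theorem_of_calculus)
    fix x :: real
    show "(g has_vector_derivative fourier_mode (- k) x) (at x within {0..2 * pi})"
      unfolding g_def fourier_mode_def using False
      by (auto intro!: derivative_eq_intros has_vector_derivative_real_field
          simp: field_simps)
  qed simp
  moreover have "g (2 * pi) = g 0"
    using fourier_mode_periodic [of "- k" 0] by (simp add: g_def)
  ultimately have "integral {0..2 * pi} (fourier_mode (- k)) = 0"
    by (simp add: integral_unique)
  moreover have "(LINT x|circ. fourier_mode (- k) x) = integral {0..2 * pi} (fourier_mode (- k))"
    by (rule lebesgue_integral_eq_integral)
       (use integrable_circ_mult_mode [OF integrable_circ_const, of 1] in auto)
  ultimately show ?thesis
    using False by (simp add: fourier_coeff_circ)
qed

section \<open>Vanishing Fourier coefficients force vanishing almost everywhere\<close>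

text \<open>Stated for all \<open>f\<close> at once, the property is closed under products of polynomial functions.\<close>
lemma vanishing_coeffs_mult_polynomial:
  fixes p :: "complex \<Rightarrow> real"
  assumes "real_polynomial_function p" "integrable circ f" "\<And>k. fourier_coeff f k = 0"
  shows "integrable circ (\<lambda>x. f x * of_real (p (cis x))) \<and>
    (\<forall>k. fourier_coeff (\<lambda>x. f x * of_real (p (cis x))) k = 0)"
  using assms
proof (induction p arbitrary: f rule: real_polynomial_function.induct)
  case (linear p)
  \<comment> \<open>A real-linear \<open>p\<close> is determined by \<open>p 1\<close> and
    \<open>p \<i>\<close>. Writing cosine and sine through the modes 1 and -1 gives \<open>a\<close>
    and \<open>b\<close> as their coefficients; each mode only shifts the Fourier coefficients of
    \<open>f\<close>, which stay zero.\<close>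
  define a b where "a = (of_real (p 1) - \<i> * of_real (p \<i>)) / 2"
    and "b = (of_real (p 1) + \<i> * of_real (p \<i>)) / 2"
  have p: "p z = Re z * p 1 + Im z * p \<i>" for z
  proof -
    interpret bounded_linear p by fact
    have "p z = p (Re z *\<^sub>R 1 + Im z *\<^sub>R \<i>)"
      by (rule arg_cong [where f = p]) (simp add: complex_eq_iff)
    then show ?thesis by (simp only: add scaleR real_scaleR_def)
  qed
  have e: "complex_of_real (p (cis x)) = a * fourier_mode 1 x + b * fourier_mode (-1) x" for x
    by (subst p) (simp add: a_def b_def fourier_mode_def complex_eq_iff Re_exp Im_exp field_simps)
  have i: "integrable circ (\<lambda>x. a * (f x * fourier_mode 1 x))" "integrable circ (\<lambda>x. b * (f x * fourier_mode (-1) x))"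
    using linear by (auto intro!: integrable_mult_right)
  have "(\<lambda>x. f x * complex_of_real (p (cis x))) = (\<lambda>x. a * (f x * fourier_mode 1 x) + b * (f x * fourier_mode (-1) x))"
    by (simp add: e algebra_simps)
  then show ?case
    using i by (simp add: fourier_coeff_add fourier_coeff_cmult fourier_coeff_mult_mode linear)
next
  case (const c)
  then show ?case
    using fourier_coeff_cmult [of "of_real c" f] by (simp add: mult.commute)
next
  case (add p q)
  then show ?case by (simp add: distrib_left fourier_coeff_add)
next
  case (mult p q)
  have "\<And>k. fourier_coeff (\<lambda>x. f x * of_real (p (cis x))) k = 0"
    "integrable circ (\<lambda>x. f x * of_real (p (cis x)))"
    using mult by blast+
  from mult.IH(2) [OF this(2) this(1)] show ?case
    by (simp add: mult.assoc)
qed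

lemma continuous_on_cis_compose:
  assumes "continuous_on UNIV g"
  shows "continuous_on S (\<lambda>x. g (cis x))"
  by (rule continuous_on_compose2 [OF assms]) (auto intro!: continuous_intros)

text \<open>On the unit circle \<open>g\<close> is a uniform limit of real polynomials by
  Stone-Weierstrass. For a polynomial the integral is a multiple of a zeroth coefficient, hence
  zero, and the error is at most the sup distance times the L1 norm of \<open>f\<close>.\<close>

lemma vanishing_coeffs_integral_continuous:
  fixes g :: "complex \<Rightarrow> real"
  assumes f: "integrable circ f" "\<And>k. fourier_coeff f k = 0" and g: "continuous_on UNIV g"
  shows "(LINT x|circ. f x * of_real (g (cis x))) = 0"
proof -
  define N where "N = (LINT x|circ. norm (f x))"
  have N0: "N \<ge> 0" by (simp add: N_def)
  have "norm (LINT x|circ. f x * of_real (g (cis x))) \<le> 0 + e" if "e > 0" for e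
  proof -
    \<comment> \<open>Chosen so that \<open>N * d\<close> is at most \<open>e\<close>; the added 1
      covers \<open>N = 0\<close>.\<close>
    define d where "d = e / (N + 1)"
    have d: "d > 0" "N * d \<le> e"
      using N0 that by (auto simp: d_def field_simps)
    obtain p where p: "real_polynomial_function p" "\<And>z. z \<in> sphere 0 1 \<Longrightarrow> \<bar>g z - p z\<bar> < d"
      using Stone_Weierstrass_real_polynomial_function
        [OF compact_sphere continuous_on_subset [OF g subset_UNIV] d(1)] by blast
    have pc: "continuous_on UNIV p"
      using p(1) by (simp add: continuous_on_polymonial_function real_polynomial_function_eq)
    note pv = vanishing_coeffs_mult_polynomial [OF p(1) f]
    have p0: "(LINT x|circ. f x * of_real (p (cis x))) = 0"
      using pv [THEN conjunct2, rule_format, of 0] by (simp add: fourier_coeff_circ)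
    have "bounded ((\<lambda>x. g (cis x)) ` {0..2 * pi})"
      by (intro compact_imp_bounded compact_continuous_image continuous_on_cis_compose g compact_Icc)
    then obtain C where C: "\<And>x. x \<in> {0..2 * pi} \<Longrightarrow> \<bar>g (cis x)\<bar> \<le> C"
      unfolding bounded_iff by force
    have gi: "integrable circ (\<lambda>x. f x * of_real (g (cis x)))"
      by (rule integrable_circ_mult_bounded [where B = C])
         (use f C in \<open>auto intro!: continuous_measurable_circ continuous_on_of_real continuous_on_cis_compose g\<close>)
    have "(LINT x|circ. f x * of_real (g (cis x)))
        = (LINT x|circ. f x * of_real (g (cis x)) - f x * of_real (p (cis x)))"
      using gi pv p0 by simp
    also have "norm \<dots> \<le> (LINT x|circ. norm (f x) * d)"
    proof (rule Bochner_Integration.integral_norm_bound_integral)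
      show "norm (f x * of_real (g (cis x)) - f x * of_real (p (cis x))) \<le> norm (f x) * d" for x
      proof -
        have "\<bar>g (cis x) - p (cis x)\<bar> \<le> d"
          using p(2) [of "cis x"] by simp
        moreover have "norm (f x * of_real (g (cis x)) - f x * of_real (p (cis x)))
            = norm (f x) * \<bar>g (cis x) - p (cis x)\<bar>"
          by (simp add: norm_mult flip: right_diff_distrib of_real_diff)
        ultimately show ?thesis by (simp add: mult_left_mono)
      qed
    qed (use gi pv f in auto)
    also have "\<dots> = N * d" by (simp add: N_def)
    finally show ?thesis using d by simp
  qed
  then have "norm (LINT x|circ. f x * of_real (g (cis x))) \<le> 0"
    by (rule field_le_epsilon)
  then show ?thesis by simp
qed

text \<open>The indicator of an arc is a bounded limit of the functions \<open>max 0 (1 - n dist(z, A))\<close>.\<close>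
lemma vanishing_coeffs_integral_arc:
  assumes f: "integrable circ f" "\<And>k. fourier_coeff f k = 0" and ab: "0 < a" "b < 2 * pi"
  shows "(LINT x|circ. f x * of_real (indicator {a..b} x)) = 0"
proof (cases "a \<le> b")
  case True
  define A where "A = cis ` {a..b}"
  have A: "closed A" "A \<noteq> {}"
    using True unfolding A_def
    by (auto intro!: compact_imp_closed compact_continuous_image continuous_intros)
  define g where "g n z = max 0 (1 - real n * infdist z A)" for n z
  have g: "continuous_on UNIV (g n)" for n
    unfolding g_def by (intro continuous_intros)
  have cis: "cis x \<in> A \<longleftrightarrow> x \<in> {a..b}" if "x \<in> {0..2 * pi}" for x
  proof
    assume "cis x \<in> A"
    then obtain y where y: "y \<in> {a..b}" "cis x = cis y" by (auto simp: A_def)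
    then have "cis (x - y) = 1" by (simp flip: cis_divide)
    then have "cos (x - y) = 1" by (simp add: complex_eq_iff)
    then obtain n :: int where n: "x - y = of_int n * (2 * pi)"
      by (auto simp: cos_one_2pi_int)
    \<comment> \<open>The arc stays strictly inside the period, so it misses the point where 0 and
      \<open>2 * pi\<close> are glued together; a nonzero multiple of \<open>2 * pi\<close> is
      therefore excluded.\<close>
    have "\<bar>x - y\<bar> < 2 * pi" using that y ab by auto
    then have "\<bar>of_int n :: real\<bar> * (2 * pi) < 1 * (2 * pi)" by (simp add: n abs_mult)
    then have "n = 0" by (simp del: mult_1)
    with n y show "x \<in> {a..b}" by simp
  qed (auto simp: A_def)
  have "(\<lambda>n. LINT x|circ. f x * of_real (g n (cis x))) \<longlonglongrightarrow> (LINT x|circ. f x * of_real (indicator {a..b} x))"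
  proof (rule integral_dominated_convergence [where w = "\<lambda>x. norm (f x)"])
    show "(\<lambda>x. f x * of_real (indicator {a..b} x)) \<in> borel_measurable circ"
    proof -
      have "indicat_real {a..b} \<in> borel_measurable circ"
        by (intro measurable_restrict_space1 borel_measurable_indicator) auto
      then show ?thesis
        using f(1) by (intro borel_measurable_times borel_measurable_of_real) auto
    qed
    show "(\<lambda>x. f x * of_real (g n (cis x))) \<in> borel_measurable circ" for n
      by (intro borel_measurable_times borel_measurable_integrable [OF f(1)] continuous_measurable_circ
          continuous_on_of_real continuous_on_cis_compose g)
    show "AE x in circ. (\<lambda>n. f x * of_real (g n (cis x))) \<longlonglongrightarrow> f x * of_real (indicator {a..b} x)"
    proof (rule AE_I2)
      fix x assume x: "x \<in> space circ"
      have "(\<lambda>n. g n (cis x)) \<longlonglongrightarrow> indicator {a..b} x"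
      proof (cases "x \<in> {a..b}")
        case True
        then show ?thesis
          using cis x by (simp add: g_def A in_closed_iff_infdist_zero [symmetric])
      next
        case False
        \<comment> \<open>As \<open>A\<close> is closed, a point outside it has positive distance,
          and the cut-off is exactly 0 once \<open>n\<close> times this distance exceeds 1.\<close>
        then have "infdist (cis x) A > 0"
          using cis [of x] x A in_closed_iff_infdist_zero [of A "cis x"] infdist_nonneg [of "cis x" A]
          by auto
        then have "eventually (\<lambda>n. 1 < real n * infdist (cis x) A) sequentially"
          by (intro filterlim_at_top_mult_tendsto_pos [OF tendsto_const _ filterlim_real_sequentially,
                THEN filterlim_at_top_dense [THEN iffD1], rule_format])
        then have "eventually (\<lambda>n. g n (cis x) = 0) sequentially"
          by eventually_elim (simp add: g_def)
        then show ?thesis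
          using False by (simp add: tendsto_eventually)
      qed
      then show "(\<lambda>n. f x * of_real (g n (cis x))) \<longlonglongrightarrow> f x * of_real (indicator {a..b} x)"
        by (intro tendsto_intros)
    qed
    show "AE x in circ. norm (f x * of_real (g n (cis x))) \<le> norm (f x)" for n
      by (intro AE_I2) (auto simp: g_def norm_mult infdist_nonneg intro!: mult_left_le)
  qed (use f in auto)
  then show ?thesis
    by (simp add: vanishing_coeffs_integral_continuous f g LIMSEQ_const_iff)
qed (simp add: indicator_def)

text \<open>The integral of \<open>f\<close> over every arc inside the open period is zero, and
  Lebesgue differentiation recovers \<open>f\<close> almost everywhere from these integrals.\<close>

theorem vanishing_coeffs_AE_0:
  assumes f: "integrable circ f" "\<And>k. fourier_coeff f k = 0"
  shows "AE x in circ. f x = 0"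
proof -
  \<comment> \<open>Extension by zero, so that the differentiation theorem on the whole line
    applies.\<close>
  define h where "h x = indicator {0..2 * pi} x *\<^sub>R f x" for x
  have h: "integrable lebesgue h"
    using f(1) unfolding h_def by (simp add: integrable_restrict_space)
  have hs: "set_integrable lebesgue {a..b} h" for a b
    using h unfolding set_integrable_def by (intro integrable_mult_indicator) auto
  have "h integrable_on cbox a b" for a b
    using set_lebesgue_integral_eq_integral(1) [OF hs] by simp
  \<comment> \<open>Lebesgue differentiation: outside a null set, the right-hand difference
    quotients of the indefinite integral of \<open>h\<close> converge to \<open>h\<close>.\<close>
  then obtain N where N: "negligible N"
    "\<And>x e. \<lbrakk>x \<notin> N; 0 < e\<rbrakk> \<Longrightarrow> \<exists>d>0. \<forall>t. 0 < t \<and> t < d \<longrightarrow>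
        norm (integral (cbox x (x + t *\<^sub>R One)) h /\<^sub>R t ^ DIM(real) - h x) < e"
    by (rule integrable_ccontinuous_explicit [of h]) (blast | assumption)+
  have zero: "integral {a..b} h = 0" if "0 < a" "b < 2 * pi" for a b
  proof -
    have "integral {a..b} h = (LINT x:{a..b}|lebesgue. h x)"
      using set_lebesgue_integral_eq_integral(2) [OF hs] by simp
    also have "\<dots> = (LINT x|circ. f x * of_real (indicator {a..b} x))"
      by (simp add: set_lebesgue_integral_def integral_restrict_space h_def scaleR_conv_of_real ac_simps)
    finally show ?thesis
      using vanishing_coeffs_integral_arc [OF f that] by simp
  qed
  have ptw: "f x = 0" if "x \<notin> N" "0 < x" "x < 2 * pi" for x
  proof (rule ccontr)
    assume "f x \<noteq> 0"
    then have "norm (f x) > 0" by simp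
    \<comment> \<open>The tolerance is \<open>norm (f x)\<close> itself: the averages over short
      intervals are zero, which would give \<open>norm (f x) < norm (f x)\<close>.\<close>
    from N(2) [OF that(1) this] obtain d where d: "d > 0"
      "\<And>t. 0 < t \<Longrightarrow> t < d \<Longrightarrow> norm (integral {x..x + t} h /\<^sub>R t - h x) < norm (f x)"
      by auto
    define t where "t = min (d / 2) ((2 * pi - x) / 2)"
    have "0 < t" "t < d" "x + t < 2 * pi"
      using d that by (auto simp: t_def min_def field_simps)
    with d(2) [of t] zero [of x "x + t"] that show False
      by (simp add: h_def)
  qed
  have "N \<union> {0, 2 * pi} \<in> null_sets lebesgue"
    using N(1) by (simp flip: negligible_iff_null_sets)
  then have "AE x in lebesgue. x \<notin> N \<union> {0, 2 * pi}"
    by (rule AE_not_in)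
  then have "AE x in lebesgue. x \<in> {0..2 * pi} \<longrightarrow> f x = 0"
  proof eventually_elim
    case (elim x)
    then show ?case using ptw [of x] by (auto simp: less_le)
  qed
  then show ?thesis
    by (subst AE_restrict_space_iff) auto
qed

section \<open>Weighted square-summable coefficients\<close>

definition weight :: "real \<Rightarrow> int \<Rightarrow> real" where
  "weight m k = (1 + (of_int k)\<^sup>2) powr m"

lemma one_plus_square_pos [simp]: "0 < 1 + (x::real)\<^sup>2"
  by (simp add: add_pos_nonneg)

lemma weight_pos [simp]: "0 < weight m k"
  using one_plus_square_pos [of "of_int k"] by (simp add: weight_def del: one_plus_square_pos)

lemma weight_nonneg [simp]: "0 \<le> weight m k"
  by (simp add: less_imp_le)

lemma weight_half_square: "(weight (m / 2) k)\<^sup>2 = weight m k"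
  by (simp add: weight_def power2_eq_square flip: powr_add)

lemma weight_minus: "weight (- m) k = inverse (weight m k)"
  by (simp add: weight_def powr_minus)

text \<open>Since (a + b)^2 <= 2 a^2 + 2 b^2, the base on the left is at most 4 times the larger of
  the two bases on the right. Taking powers preserves this because \<open>m\<close> is nonnegative,
  and a maximum is at most the sum.\<close>

lemma weight_add_le:
  assumes "0 \<le> m"
  shows "weight m (j + k) \<le> 4 powr m * (weight m j + weight m k)"
proof -
  define a b :: real where "a = of_int j" and "b = of_int k"
  define M where "M = max (1 + a\<^sup>2) (1 + b\<^sup>2)"
  have "(a + b)\<^sup>2 \<le> 2 * a\<^sup>2 + 2 * b\<^sup>2"
    using sum_squares_ge_zero [of "a - b" 0] by (simp add: power2_eq_square algebra_simps)
  then have "1 + (a + b)\<^sup>2 \<le> 4 * M"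
    by (simp add: M_def max_def)
  then have "(1 + (a + b)\<^sup>2) powr m \<le> (4 * M) powr m"
    by (intro powr_mono2 assms) (auto simp: add_nonneg_nonneg)
  also have "\<dots> = 4 powr m * M powr m"
    by (intro powr_mult)
  also have "\<dots> \<le> 4 powr m * ((1 + a\<^sup>2) powr m + (1 + b\<^sup>2) powr m)"
    by (intro mult_left_mono) (auto simp: M_def max_def)
  finally show ?thesis
    by (simp add: weight_def a_def b_def)
qed

text \<open>Comparison with the p-series of exponent 2m, which exceeds 1; evenness of the weight
  carries the result to negative indices.\<close>

lemma summable_weight_minus:
  assumes m: "m > 1 / 2"
  shows "weight (- m) summable_on UNIV"
proof -
  have s: "summable (\<lambda>n. weight (- m) (int n))"
  proof (rule summable_comparison_test' [where N = 1])
    show "summable (\<lambda>n. real n powr (- 2 * m))"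
      using m by (simp add: summable_real_powr_iff)
    show "norm (weight (- m) (int n)) \<le> real n powr (- 2 * m)" if "n \<ge> 1" for n
    proof -
      have "weight (- m) (int n) \<le> ((real n)\<^sup>2) powr (- m)"
        unfolding weight_def using that m by (intro powr_mono2') auto
      also have "\<dots> = real n powr (- 2 * m)"
        using powr_powr [of "real n" 2 "- m"] that by simp
      finally show ?thesis by simp
    qed
  qed
  have even: "weight m (- k) = weight m k" for m k
    by (simp add: weight_def)
  \<comment> \<open>The shift by one keeps the index 0 in the nonnegative half only, so that the two
    halves are disjoint.\<close>
  have i: "inj_on (\<lambda>n. - int (Suc n)) UNIV" by (auto intro: injI)
  have 1: "weight (- m) summable_on range int"
    using s by (subst summable_on_reindex) (auto simp: o_def intro!: norm_summable_imp_summable_on)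
  have 2: "weight (- m) summable_on range (\<lambda>n. - int (Suc n))"
  proof (subst summable_on_reindex [OF i])
    have "summable (\<lambda>n. weight (- m) (int (Suc n)))"
      using s by (subst summable_Suc_iff)
    then show "(weight (- m) \<circ> (\<lambda>n. - int (Suc n))) summable_on UNIV"
      by (auto simp: o_def even simp del: of_nat_Suc intro!: norm_summable_imp_summable_on)
  qed
  have "k \<in> range int \<union> range (\<lambda>n. - int (Suc n))" for k
    by (cases k) auto
  then have "range int \<union> range (\<lambda>n. - int (Suc n)) = UNIV" by blast
  moreover have "range int \<inter> range (\<lambda>n. - int (Suc n)) = {}" by auto
  ultimately show ?thesis
    using summable_on_Un_disjoint [OF 1 2] by metis
qed

definition weight_const :: "real \<Rightarrow> real" where
  "weight_const m = (\<Sum>\<^sub>\<infinity>k\<in>UNIV. weight (- m) k)"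

lemma weight_const_nonneg [simp]: "0 \<le> weight_const m"
  by (simp add: weight_const_def infsum_nonneg)

lemma sum_weight_minus_le:
  assumes "m > 1 / 2" "finite F"
  shows "(\<Sum>k\<in>F. weight (- m) k) \<le> weight_const m"
  unfolding weight_const_def
  by (rule finite_sum_le_infsum) (use assms in \<open>auto intro: summable_weight_minus\<close>)

section \<open>Balls in the weighted sequence space\<close>

text \<open>Bounding all finite partial sums expresses summability and the norm bound at once, and
  gives access to the Minkowski and Cauchy-Schwarz inequalities for \<open>L2_set\<close>. The
  exponent is halved because the weights are squared there; the empty \<open>F\<close> forces
  \<open>X\<close> to be nonnegative.\<close>

definition coeff_ball :: "real \<Rightarrow> real \<Rightarrow> (int \<Rightarrow> complex) set" where
  "coeff_ball m X = {c. \<forall>F. finite F \<longrightarrow> L2_set (\<lambda>k. weight (m / 2) k * norm (c k)) F \<le> X}"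

lemma coeff_ballI:
  "(\<And>F. finite F \<Longrightarrow> L2_set (\<lambda>k. weight (m / 2) k * norm (c k)) F \<le> X) \<Longrightarrow> c \<in> coeff_ball m X"
  by (simp add: coeff_ball_def)

lemma coeff_ballD:
  "c \<in> coeff_ball m X \<Longrightarrow> finite F \<Longrightarrow> L2_set (\<lambda>k. weight (m / 2) k * norm (c k)) F \<le> X"
  by (simp add: coeff_ball_def)

lemma coeff_ball_nonneg: "c \<in> coeff_ball m X \<Longrightarrow> 0 \<le> X"
  using coeff_ballD [of c m X "{}"] by simp

lemma L2_set_weight: "(L2_set (\<lambda>k. weight (m / 2) k * norm (c k)) F)\<^sup>2 = (\<Sum>k\<in>F. weight m k * (norm (c k))\<^sup>2)"
  by (simp add: L2_set_def sum_nonneg power_mult_distrib weight_half_square)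

lemma coeff_ball_iff:
  "c \<in> coeff_ball m X \<longleftrightarrow> 0 \<le> X \<and> (\<forall>F. finite F \<longrightarrow> (\<Sum>k\<in>F. weight m k * (norm (c k))\<^sup>2) \<le> X\<^sup>2)"
  unfolding L2_set_weight [symmetric]
  by (auto simp: coeff_ball_nonneg power_mono coeff_ballD intro!: coeff_ballI intro: power2_le_imp_le)

lemma coeff_ball_add:
  assumes "c \<in> coeff_ball m X" "d \<in> coeff_ball m Y"
  shows "(\<lambda>k. c k + d k) \<in> coeff_ball m (X + Y)"
proof (rule coeff_ballI)
  fix F :: "int set" assume F: "finite F"
  have "L2_set (\<lambda>k. weight (m / 2) k * norm (c k + d k)) F
      \<le> L2_set (\<lambda>k. weight (m / 2) k * norm (c k) + weight (m / 2) k * norm (d k)) F"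
    by (intro L2_set_mono) (auto simp: norm_triangle_ineq mult_left_mono simp flip: distrib_left)
  also have "\<dots> \<le> L2_set (\<lambda>k. weight (m / 2) k * norm (c k)) F + L2_set (\<lambda>k. weight (m / 2) k * norm (d k)) F"
    by (rule L2_set_triangle_ineq)
  also have "\<dots> \<le> X + Y"
    using assms F by (intro add_mono coeff_ballD)
  finally show "L2_set (\<lambda>k. weight (m / 2) k * norm (c k + d k)) F \<le> X + Y" .
qed

lemma coeff_ball_mult:
  assumes "c \<in> coeff_ball m X" "0 \<le> e" "\<And>k. norm (\<sigma> k) \<le> e"
  shows "(\<lambda>k. \<sigma> k * c k) \<in> coeff_ball m (e * X)"
proof (rule coeff_ballI)
  fix F :: "int set" assume F: "finite F"
  have "L2_set (\<lambda>k. weight (m / 2) k * norm (\<sigma> k * c k)) F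
      \<le> L2_set (\<lambda>k. e * (weight (m / 2) k * norm (c k))) F"
    by (intro L2_set_mono)
       (auto simp: norm_mult assms mult_right_mono mult.left_commute [of "weight (m / 2) _"])
  also have "\<dots> = e * L2_set (\<lambda>k. weight (m / 2) k * norm (c k)) F"
    by (simp add: L2_set_right_distrib assms)
  also have "\<dots> \<le> e * X"
    using assms F by (intro mult_left_mono coeff_ballD)
  finally show "L2_set (\<lambda>k. weight (m / 2) k * norm (\<sigma> k * c k)) F \<le> e * X" .
qed

text \<open>Each term is the product of \<open>weight (- m / 2) k\<close> and the weighted
  coefficient; Cauchy-Schwarz bounds every finite sum, the first factor being square-summable for m
  > 1/2.\<close>

lemma coeff_ball_abs_summable:
  assumes c: "c \<in> coeff_ball m X" and m: "m > 1 / 2"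
  shows "(\<lambda>k. norm (c k)) summable_on UNIV"
proof (rule nonneg_bdd_above_summable_on)
  have "(\<Sum>k\<in>F. norm (c k)) \<le> sqrt (weight_const m) * X" if F: "finite F" for F
  proof -
    have "(\<Sum>k\<in>F. norm (c k)) = (\<Sum>k\<in>F. \<bar>weight (- m / 2) k\<bar> * \<bar>weight (m / 2) k * norm (c k)\<bar>)"
      by (intro sum.cong refl) (simp add: weight_minus less_imp_neq [symmetric])
    also have "\<dots> \<le> L2_set (weight (- m / 2)) F * L2_set (\<lambda>k. weight (m / 2) k * norm (c k)) F"
      by (rule L2_set_mult_ineq)
    also have "\<dots> \<le> sqrt (weight_const m) * X"
      using weight_half_square [of "- m"] F m
      by (intro mult_mono coeff_ballD [OF c F]) (auto simp: L2_set_def sum_weight_minus_le sum_nonneg)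
    finally show ?thesis .
  qed
  then show "bdd_above (sum (\<lambda>k. norm (c k)) ` {F. F \<subseteq> UNIV \<and> finite F})"
    by (intro bdd_aboveI2) auto
qed simp

text \<open>Cauchy--Schwarz in \<open>k\<close> with the weight quotient
  \<open>w(n) / (w(k) w(n - k)) \<le> 4\<^sup>m (1 / w(k) + 1 / w(n - k))\<close>, which is summable
  uniformly in \<open>n\<close>; then sum over \<open>n\<close> first.\<close>
lemma coeff_ball_convolution:
  assumes m: "m > 1 / 2" and c: "c \<in> coeff_ball m X" and d: "d \<in> coeff_ball m Y"
    and W: "\<And>n. ((\<lambda>k. c k * d (n - k)) has_sum W n) UNIV"
  shows "W \<in> coeff_ball m (sqrt (2 * 4 powr m * weight_const m) * (X * Y))"
  unfolding coeff_ball_iff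
proof (intro conjI allI impI)
  define A where "A = 2 * 4 powr m * weight_const m"
  have A0: "0 \<le> A" by (simp add: A_def)
  show "0 \<le> sqrt (2 * 4 powr m * weight_const m) * (X * Y)"
    using coeff_ball_nonneg [OF c] coeff_ball_nonneg [OF d] by simp
  fix F :: "int set" assume F: "finite F"
  define P where "P k = weight m k * (norm (c k))\<^sup>2" for k
  define Q where "Q k = weight m k * (norm (d k))\<^sup>2" for k
  have PQ0: "0 \<le> P k" "0 \<le> Q k" for k by (simp_all add: P_def Q_def)
  have P: "sum P G \<le> X\<^sup>2" if "finite G" for G
    using c that by (simp add: coeff_ball_iff P_def)
  have Q: "(\<Sum>n\<in>F. Q (n - k)) \<le> Y\<^sup>2" for k
  proof -
    have "(\<Sum>n\<in>F. Q (n - k)) = sum Q ((\<lambda>n. n - k) ` F)"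
      by (subst sum.reindex) (auto intro: inj_onI)
    then show ?thesis using d F by (simp add: coeff_ball_iff Q_def)
  qed
  have q: "(\<Sum>k\<in>G. weight m n * weight (- m) k * weight (- m) (n - k)) \<le> A" if G: "finite G" for n G
  proof -
    have "weight m n * weight (- m) k * weight (- m) (n - k)
        \<le> 4 powr m * (weight (- m) k + weight (- m) (n - k))" for k
    proof -
      have "weight m n \<le> 4 powr m * (weight m k + weight m (n - k))"
        using weight_add_le [of m k "n - k"] m by simp
      then have "weight m n * (weight (- m) k * weight (- m) (n - k))
          \<le> 4 powr m * (weight m k + weight m (n - k)) * (weight (- m) k * weight (- m) (n - k))"
        by (intro mult_right_mono) auto
      also have "\<dots> = 4 powr m * (weight (- m) k + weight (- m) (n - k))"
        using weight_pos [of m k] weight_pos [of m "n - k"]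
        by (simp add: weight_minus field_simps del: weight_pos)
      finally show ?thesis by (simp add: mult.assoc)
    qed
    then have "(\<Sum>k\<in>G. weight m n * weight (- m) k * weight (- m) (n - k))
        \<le> (\<Sum>k\<in>G. 4 powr m * (weight (- m) k + weight (- m) (n - k)))"
      by (rule sum_mono)
    \<comment> \<open>Reflecting the index by k -> n - k makes the second half another finite
      partial sum of the same series.\<close>
    also have "\<dots> = 4 powr m * ((\<Sum>k\<in>G. weight (- m) k) + (\<Sum>k\<in>(\<lambda>k. n - k) ` G. weight (- m) k))"
      by (subst sum.reindex) (auto intro: inj_onI simp: sum.distrib simp flip: sum_distrib_left)
    also have "\<dots> \<le> 4 powr m * (weight_const m + weight_const m)"
      using m G by (intro mult_left_mono add_mono sum_weight_minus_le) auto
    finally show ?thesis by (simp add: A_def)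
  qed
  \<comment> \<open>The inner sum is truncated to a finite \<open>G\<close> with a bound free of
    \<open>G\<close>, so that all rearrangements are finite; the limit in \<open>G\<close> is taken
    at the end.\<close>
  have fin: "(\<Sum>n\<in>F. weight m n * (norm (\<Sum>k\<in>G. c k * d (n - k)))\<^sup>2) \<le> A * (X\<^sup>2 * Y\<^sup>2)"
    if G: "finite G" for G
  proof -
    have "weight m n * (norm (\<Sum>k\<in>G. c k * d (n - k)))\<^sup>2 \<le> A * (\<Sum>k\<in>G. P k * Q (n - k))" for n
    proof -
      \<comment> \<open>The factor \<open>a\<close> carries the weight quotient and \<open>b\<close>
        the data, so that Cauchy-Schwarz yields the uniformly bounded kernel sum times a sum of
        products of \<open>P\<close> and \<open>Q\<close>.\<close>
      define a b where "a k = weight (m / 2) n * weight (- m / 2) k * weight (- m / 2) (n - k)"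
        and "b k = weight (m / 2) k * norm (c k) * (weight (m / 2) (n - k) * norm (d (n - k)))" for k
      have ab: "a k * b k = weight (m / 2) n * norm (c k * d (n - k))" for k
        using weight_pos [of "m / 2" k] weight_pos [of "m / 2" "n - k"]
        by (simp add: a_def b_def weight_minus norm_mult field_simps del: weight_pos)
      have ab0: "0 \<le> a k" "0 \<le> b k" for k by (simp_all add: a_def b_def)
      have "weight (m / 2) n * norm (\<Sum>k\<in>G. c k * d (n - k)) \<le> weight (m / 2) n * (\<Sum>k\<in>G. norm (c k * d (n - k)))"
        by (intro mult_left_mono norm_sum) auto
      also have "\<dots> = (\<Sum>k\<in>G. \<bar>a k\<bar> * \<bar>b k\<bar>)"
        by (simp add: ab0 ab sum_distrib_left)
      also have "\<dots> \<le> L2_set a G * L2_set b G"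
        by (rule L2_set_mult_ineq)
      finally have "(weight (m / 2) n * norm (\<Sum>k\<in>G. c k * d (n - k)))\<^sup>2 \<le> (L2_set a G * L2_set b G)\<^sup>2"
        by (intro power_mono) auto
      also have "\<dots> = (\<Sum>k\<in>G. (a k)\<^sup>2) * (\<Sum>k\<in>G. (b k)\<^sup>2)"
        by (simp add: L2_set_def power_mult_distrib sum_nonneg)
      also have "(\<Sum>k\<in>G. (a k)\<^sup>2) = (\<Sum>k\<in>G. weight m n * weight (- m) k * weight (- m) (n - k))"
        by (simp only: a_def power_mult_distrib weight_half_square)
      also have "(\<Sum>k\<in>G. (b k)\<^sup>2) = (\<Sum>k\<in>G. P k * Q (n - k))"
        by (simp only: b_def P_def Q_def power_mult_distrib weight_half_square)
      also have "(\<Sum>k\<in>G. weight m n * weight (- m) k * weight (- m) (n - k)) * (\<Sum>k\<in>G. P k * Q (n - k))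
          \<le> A * (\<Sum>k\<in>G. P k * Q (n - k))"
        using q [OF G] by (intro mult_right_mono sum_nonneg mult_nonneg_nonneg PQ0)
      finally show ?thesis by (simp add: power_mult_distrib weight_half_square)
    qed
    then have "(\<Sum>n\<in>F. weight m n * (norm (\<Sum>k\<in>G. c k * d (n - k)))\<^sup>2)
        \<le> (\<Sum>n\<in>F. A * (\<Sum>k\<in>G. P k * Q (n - k)))"
      by (rule sum_mono)
    \<comment> \<open>With \<open>k\<close> fixed, \<open>n - k\<close> runs through a translate of
      \<open>F\<close>, so the sum over \<open>n\<close> is bounded by \<open>Y\<^sup>2\<close> for
      every \<open>k\<close>.\<close>
    also have "\<dots> = A * (\<Sum>k\<in>G. \<Sum>n\<in>F. P k * Q (n - k))"
      by (subst sum.swap) (simp add: sum_distrib_left)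
    also have "\<dots> = A * (\<Sum>k\<in>G. P k * (\<Sum>n\<in>F. Q (n - k)))"
      by (simp add: sum_distrib_left)
    also have "\<dots> \<le> A * (\<Sum>k\<in>G. P k * Y\<^sup>2)"
      by (intro mult_left_mono sum_mono Q PQ0 A0)
    also have "\<dots> = A * (sum P G * Y\<^sup>2)"
      by (simp add: sum_distrib_right)
    also have "\<dots> \<le> A * (X\<^sup>2 * Y\<^sup>2)"
      by (intro mult_left_mono mult_right_mono P G A0) auto
    finally show ?thesis .
  qed
  have "((\<lambda>G. \<Sum>n\<in>F. weight m n * (norm (\<Sum>k\<in>G. c k * d (n - k)))\<^sup>2)
      \<longlongrightarrow> (\<Sum>n\<in>F. weight m n * (norm (W n))\<^sup>2)) (finite_subsets_at_top UNIV)"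
    using W unfolding has_sum_def by (intro tendsto_intros)
  then have "(\<Sum>n\<in>F. weight m n * (norm (W n))\<^sup>2) \<le> A * (X\<^sup>2 * Y\<^sup>2)"
    by (rule tendsto_upperbound) (auto intro!: eventually_finite_subsets_at_top_weakI fin)
  then show "(\<Sum>n\<in>F. weight m n * (norm (W n))\<^sup>2) \<le> (sqrt (2 * 4 powr m * weight_const m) * (X * Y))\<^sup>2"
    using A0 by (simp add: A_def power_mult_distrib)
qed

section \<open>Absolutely convergent Fourier series\<close>

definition fourier_series :: "(int \<Rightarrow> complex) \<Rightarrow> real \<Rightarrow> complex" where
  "fourier_series c x = (\<Sum>\<^sub>\<infinity>k\<in>UNIV. c k * fourier_mode k x)"

text \<open>The remainder is the series over the complement of \<open>F\<close>, bounded by its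
  absolute sum because modes have modulus 1. The bound is free of \<open>x\<close>, which yields
  uniform convergence and control of integrals.\<close>

lemma fourier_series_tail:
  assumes c: "(\<lambda>k. norm (c k)) summable_on UNIV" and F: "finite F"
  shows "norm (fourier_series c x - (\<Sum>k\<in>F. c k * fourier_mode k x))
    \<le> (\<Sum>\<^sub>\<infinity>k\<in>UNIV. norm (c k)) - (\<Sum>k\<in>F. norm (c k))"
proof -
  let ?f = "\<lambda>k. c k * fourier_mode k x"
  have s: "(\<lambda>k. norm (?f k)) summable_on UNIV"
    using c by (simp add: norm_mult)
  have sf: "?f summable_on UNIV"
    by (rule abs_summable_summable [OF s])
  have d: "UNIV - F = - F" by auto
  have "fourier_series c x - (\<Sum>k\<in>F. ?f k) = infsum ?f (- F)"
    unfolding fourier_series_def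
    using infsum_Diff [OF sf, of F] F d by simp
  also have "norm \<dots> \<le> (\<Sum>\<^sub>\<infinity>k\<in>- F. norm (?f k))"
    by (rule norm_infsum_bound) (use s in \<open>auto intro: summable_on_subset_banach\<close>)
  also have "\<dots> = (\<Sum>\<^sub>\<infinity>k\<in>UNIV. norm (c k)) - (\<Sum>k\<in>F. norm (c k))"
    using infsum_Diff [OF c, of F] F d by (simp add: norm_mult)
  finally show ?thesis .
qed

lemma tail_tendsto_0:
  fixes c :: "int \<Rightarrow> complex"
  assumes "(\<lambda>k. norm (c k)) summable_on UNIV"
  shows "((\<lambda>F. (\<Sum>\<^sub>\<infinity>k\<in>UNIV. norm (c k)) - (\<Sum>k\<in>F. norm (c k))) \<longlongrightarrow> 0) (finite_subsets_at_top UNIV)"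
  using tendsto_diff [OF tendsto_const has_sum_infsum [OF assms, unfolded has_sum_def], of "\<Sum>\<^sub>\<infinity>k\<in>UNIV. norm (c k)"]
  by simp

lemma fourier_series_uniform_limit:
  assumes c: "(\<lambda>k. norm (c k)) summable_on UNIV"
  shows "uniform_limit S (\<lambda>F x. \<Sum>k\<in>F. c k * fourier_mode k x) (fourier_series c) (finite_subsets_at_top UNIV)"
proof (rule uniform_limitI)
  fix e :: real assume "e > 0"
  from order_tendstoD(2) [OF tail_tendsto_0 [OF c] this]
  have "eventually (\<lambda>F. finite F \<and> (\<Sum>\<^sub>\<infinity>k\<in>UNIV. norm (c k)) - (\<Sum>k\<in>F. norm (c k)) < e)
      (finite_subsets_at_top UNIV)"
    by (auto intro: eventually_conj eventually_finite_subsets_at_top_weakI)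
  then show "eventually (\<lambda>F. \<forall>x\<in>S. dist (\<Sum>k\<in>F. c k * fourier_mode k x) (fourier_series c x) < e)
      (finite_subsets_at_top UNIV)"
  proof eventually_elim
    case (elim F)
    then show ?case
      using fourier_series_tail [OF c, of F]
      by (auto simp: dist_norm norm_minus_commute intro: le_less_trans)
  qed
qed

lemma continuous_on_fourier_series:
  assumes c: "(\<lambda>k. norm (c k)) summable_on UNIV"
  shows "continuous_on S (fourier_series c)"
  by (rule uniform_limit_theorem [OF _ fourier_series_uniform_limit [OF c]])
     (auto intro!: always_eventually continuous_intros)

lemma norm_fourier_series_le:
  assumes c: "(\<lambda>k. norm (c k)) summable_on UNIV"
  shows "norm (fourier_series c x) \<le> (\<Sum>\<^sub>\<infinity>k\<in>UNIV. norm (c k))"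
  using fourier_series_tail [OF c, of "{}"] by simp

lemma fourier_series_periodic: "fourier_series c (x + 2 * pi) = fourier_series c x"
  by (simp add: fourier_series_def)

text \<open>The convolution formula. For finite partial sums it is linearity together with the shift
  rule; replacing the partial sum by the series changes a coefficient by at most the tail times the
  mean of \<open>norm (v x)\<close>.\<close>

lemma fourier_coeff_mult_series:
  assumes v: "integrable circ v" and c: "(\<lambda>k. norm (c k)) summable_on UNIV"
  shows "((\<lambda>k. c k * fourier_coeff v (n - k)) has_sum fourier_coeff (\<lambda>x. fourier_series c x * v x) n) UNIV"
  unfolding has_sum_def
proof (rule LIM_zero_cancel)
  let ?t = "\<lambda>F. (\<Sum>\<^sub>\<infinity>k\<in>UNIV. norm (c k)) - (\<Sum>k\<in>F. norm (c k))"
  let ?N = "LINT x|circ. norm (v x)"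
  let ?S = "\<lambda>F x. \<Sum>k\<in>F. c k * fourier_mode k x"
  have sm: "fourier_series c \<in> borel_measurable circ"
    by (intro continuous_measurable_circ continuous_on_fourier_series c)
  have i1: "integrable circ (\<lambda>x. fourier_series c x * v x)"
    using integrable_circ_mult_bounded [OF v sm, of "\<Sum>\<^sub>\<infinity>k\<in>UNIV. norm (c k)"] norm_fourier_series_le [OF c]
    by (simp add: mult.commute)
  have i2: "integrable circ (\<lambda>x. ?S F x * v x)" for F
  proof -
    have "integrable circ (\<lambda>x. \<Sum>k\<in>F. c k * (v x * fourier_mode k x))"
      using v by (intro Bochner_Integration.integrable_sum integrable_mult_right) simp
    then show ?thesis by (simp add: sum_distrib_left sum_distrib_right ac_simps)
  qed
  have "norm ((\<Sum>k\<in>F. c k * fourier_coeff v (n - k)) - fourier_coeff (\<lambda>x. fourier_series c x * v x) n)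
      \<le> ?t F * (?N / (2 * pi))" if F: "finite F" for F
  proof -
    have "(\<Sum>k\<in>F. c k * fourier_coeff v (n - k)) = fourier_coeff (\<lambda>x. ?S F x * v x) n"
      using fourier_coeff_sum_modes [OF v, of c F n] by (simp add: sum_distrib_right)
    then have "norm ((\<Sum>k\<in>F. c k * fourier_coeff v (n - k)) - fourier_coeff (\<lambda>x. fourier_series c x * v x) n)
        = norm (fourier_coeff (\<lambda>x. ?S F x * v x - fourier_series c x * v x) n)"
      using i1 i2 by (simp add: fourier_coeff_diff)
    also have "\<dots> \<le> (LINT x|circ. norm (?S F x * v x - fourier_series c x * v x)) / (2 * pi)"
      using i1 i2 by (intro norm_fourier_coeff_le) auto
    also have "\<dots> \<le> (LINT x|circ. ?t F * norm (v x)) / (2 * pi)"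
    proof (intro divide_right_mono integral_mono)
      show "norm (?S F x * v x - fourier_series c x * v x) \<le> ?t F * norm (v x)" for x
        using fourier_series_tail [OF c F, of x]
        by (simp add: norm_minus_commute norm_mult mult_right_mono flip: left_diff_distrib)
    qed (use i1 i2 v in auto)
    finally show ?thesis by simp
  qed
  then have "eventually (\<lambda>F. norm ((\<Sum>k\<in>F. c k * fourier_coeff v (n - k)) - fourier_coeff (\<lambda>x. fourier_series c x * v x) n)
      \<le> ?t F * (?N / (2 * pi))) (finite_subsets_at_top UNIV)"
    by (intro eventually_finite_subsets_at_top_weakI)
  then show "((\<lambda>F. (\<Sum>k\<in>F. c k * fourier_coeff v (n - k)) - fourier_coeff (\<lambda>x. fourier_series c x * v x) n) \<longlongrightarrow> 0)
      (finite_subsets_at_top UNIV)"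
    by (rule Lim_null_comparison) (rule tendsto_mult_left_zero [OF tail_tendsto_0 [OF c]])
qed

text \<open>Take \<open>v = 1\<close> in the convolution formula: its only nonzero coefficient is at
  0, so only the term \<open>k = n\<close> survives.\<close>

lemma fourier_coeff_series:
  assumes c: "(\<lambda>k. norm (c k)) summable_on UNIV"
  shows "fourier_coeff (fourier_series c) n = c n"
proof -
  have "((\<lambda>k. c k * fourier_coeff (\<lambda>x. 1) (n - k)) has_sum fourier_coeff (fourier_series c) n) UNIV"
    using fourier_coeff_mult_series [OF integrable_circ_const c, of 1 n] by simp
  moreover have "((\<lambda>k. c k * fourier_coeff (\<lambda>x. 1) (n - k)) has_sum c n) UNIV"
    by (rule has_sum_finiteI [of "{n}", THEN has_sum_cong_neutral [THEN iffD1, rotated -1]])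
       (auto simp: fourier_coeff_one)
  ultimately show ?thesis by (rule has_sum_unique)
qed

section \<open>The symbols of the implicit scheme\<close>

text \<open>Far out the quotient \<open>p / q\<close> is smaller than \<open>e\<close>; on the
  remaining disc \<open>p\<close> is bounded by compactness.\<close>

lemma poly_le_poly_higher_degree:
  fixes p q :: "complex poly"
  assumes deg: "degree p < degree q" and e: "e > 0"
  obtains C where "0 \<le> C" "\<And>z. norm (poly p z) \<le> e * norm (poly q z) + C"
proof -
  have "eventually (\<lambda>z. norm (poly p z / poly q z) < e) at_infinity"
    using tendstoD [OF poly_divide_tendsto_0_at_infinity [OF deg] e] by simp
  then obtain b1 where b1: "\<And>z. b1 \<le> norm z \<Longrightarrow> norm (poly p z / poly q z) < e"
    by (auto simp: eventually_at_infinity)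
  \<comment> \<open>At a root of \<open>q\<close> the quotient is 0 by convention and says nothing
    about \<open>p\<close>, so the disc is made to contain all the roots.\<close>
  have "bounded {z. poly q z = 0}"
    using deg by (intro finite_imp_bounded poly_roots_finite) auto
  then obtain b2 where b2: "\<And>z. poly q z = 0 \<Longrightarrow> norm z \<le> b2"
    by (auto simp: bounded_iff)
  have "bounded (poly p ` cball 0 (max b1 (b2 + 1)))"
    by (intro compact_imp_bounded compact_continuous_image compact_cball continuous_intros)
  then obtain C where C: "\<And>z. norm z \<le> max b1 (b2 + 1) \<Longrightarrow> norm (poly p z) \<le> C"
    unfolding bounded_iff by fastforce
  have "norm (poly p z) \<le> e * norm (poly q z) + \<bar>C\<bar>" for z
  proof (cases "norm z \<le> max b1 (b2 + 1)")
    case True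
    have "0 \<le> e * norm (poly q z)" using e by simp
    then show ?thesis using C [OF True] by linarith
  next
    case False
    then have "poly q z \<noteq> 0" using b2 [of z] by auto
    moreover have "norm (poly p z) / norm (poly q z) < e"
      using False b1 [of z] by (auto simp: norm_divide)
    ultimately have "norm (poly p z) \<le> e * norm (poly q z)"
      by (simp add: divide_less_eq)
    then show ?thesis by simp
  qed
  then show ?thesis by (intro that [of "\<bar>C\<bar>"]) auto
qed

text \<open>For imaginary \<open>z\<close> the squared modulus of both 1 + z and 1 - z is 1 +
  |z|^2.\<close>

lemma norm_one_minus_imaginary:
  assumes "Re z = 0"
  shows "1 \<le> norm (1 - z)" "norm z \<le> norm (1 - z)" "norm (1 + z) = norm (1 - z)"
  using assms abs_Re_le_cmod [of "1 - z"] abs_Im_le_cmod [of "1 - z"]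
  by (auto simp: cmod_def)

text \<open>The denominator dominates both 1 and d|L|. It absorbs the part of \<open>M\<close>
  controlled by \<open>L\<close> for every \<open>d\<close>, and the constant part as soon as
  \<open>d\<close> is small; the threshold \<open>T\<close> is therefore the same for all
  frequencies.\<close>

lemma implicit_symbol_small:
  fixes L M :: "complex poly"
  assumes deg: "M = 0 \<or> degree M < degree L"
    and skew: "\<forall>k::real. Re (poly L (\<i> * of_real k)) = 0" and e: "e > 0"
  shows "\<exists>T>0. \<forall>\<Delta>t k. 0 < \<Delta>t \<longrightarrow> \<Delta>t < T \<longrightarrow>
    norm (complex_of_real (\<Delta>t / 2) * poly M (\<i> * of_int k)
      / (1 - complex_of_real (\<Delta>t / 2) * poly L (\<i> * of_int k))) \<le> e"
proof -
  \<comment> \<open>The zero polynomial has \<open>degree\<close> 0 here, so \<open>M = 0\<close> is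
    treated apart: it is the one case in which \<open>L\<close> may be constant.\<close>
  obtain C where C: "0 \<le> C" "\<And>z. norm (poly M z) \<le> e / 2 * norm (poly L z) + C"
  proof (cases "M = 0")
    case True
    then show ?thesis using e by (intro that [of 0]) auto
  next
    case False
    then show ?thesis using poly_le_poly_higher_degree [of M L "e / 2"] deg e that by auto
  qed
  have "norm (complex_of_real (\<Delta>t / 2) * poly M (\<i> * of_int k)
      / (1 - complex_of_real (\<Delta>t / 2) * poly L (\<i> * of_int k))) \<le> e"
    \<comment> \<open>This threshold makes \<open>d * C\<close> at most \<open>e / 2\<close>, the
      other half of \<open>e\<close> being spent on the multiple of \<open>L\<close>; the added 1
      covers \<open>C = 0\<close>.\<close>
    if t: "0 < \<Delta>t" "\<Delta>t < e / (C + 1)" for \<Delta>t k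
  proof -
    define d where "d = \<Delta>t / 2"
    define z where "z = complex_of_real d * poly L (\<i> * of_int k)"
    have d: "d > 0" "d * C \<le> e / 2"
      using t C(1) e by (auto simp: d_def field_simps)
    have "Re z = 0"
      using skew [rule_format, of "of_int k"] by (simp add: z_def)
    note n = norm_one_minus_imaginary [OF this]
    have "norm (complex_of_real d * poly M (\<i> * of_int k)) \<le> d * (e / 2 * norm (poly L (\<i> * of_int k)) + C)"
      using d C(2) by (simp add: norm_mult)
    also have "\<dots> = e / 2 * norm z + d * C"
      using d by (simp add: z_def norm_mult algebra_simps)
    also have "\<dots> \<le> e / 2 * norm (1 - z) + e / 2 * norm (1 - z)"
    proof (intro add_mono mult_left_mono n)
      have "e / 2 * 1 \<le> e / 2 * norm (1 - z)"
        using e n by (intro mult_left_mono) auto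
      then show "d * C \<le> e / 2 * norm (1 - z)" using d by linarith
    qed (use e in auto)
    finally have "norm (complex_of_real d * poly M (\<i> * of_int k)) \<le> e * norm (1 - z)"
      by (simp add: algebra_simps)
    moreover have "norm (1 - z) > 0" using n by linarith
    ultimately show ?thesis
      unfolding d_def [symmetric] z_def [symmetric] norm_divide by (simp add: divide_le_eq)
  qed
  then show ?thesis
    using C e by (intro exI [of _ "e / (C + 1)"]) auto
qed

text \<open>The Cayley transform of an imaginary number lies on the unit circle; hence the operator
  \<open>C_op\<close> does not increase Sobolev norms.\<close>

lemma cayley_symbol_norm:
  assumes "\<forall>k::real. Re (poly L (\<i> * of_real k)) = 0"
  shows "norm ((1 + complex_of_real d * poly L (\<i> * of_int k))
    / (1 - complex_of_real d * poly L (\<i> * of_int k))) = 1"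
proof -
  have "Re (complex_of_real d * poly L (\<i> * of_int k)) = 0"
    using assms [rule_format, of "of_int k"] by simp
  note n = norm_one_minus_imaginary [OF this]
  have "norm (1 - complex_of_real d * poly L (\<i> * of_int k)) \<noteq> 0"
    using n(1) by linarith
  then show ?thesis
    unfolding norm_divide n(3) by (rule divide_self)
qed

section \<open>The Sobolev algebra\<close>

lemma L2_circleD:
  assumes "u \<in> L2_circle"
  shows "u (x + 2 * pi) = u x" "u \<in> borel_measurable lebesgue" "u \<in> borel_measurable circ"
    "integrable circ (\<lambda>x. (norm (u x))\<^sup>2)" "integrable circ u"
proof -
  show 1: "u (x + 2 * pi) = u x" "u \<in> borel_measurable lebesgue"
    "integrable circ (\<lambda>x. (norm (u x))\<^sup>2)"
    using assms by (auto simp: L2_circle_def set_integrable_circ)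
  show 2: "u \<in> borel_measurable circ"
    using 1 by (intro measurable_restrict_space1)
  show "integrable circ u"
  proof (rule Bochner_Integration.integrable_bound [OF _ 2])
    show "integrable circ (\<lambda>x. 1 + (norm (u x))\<^sup>2)"
      using 1 by (intro Bochner_Integration.integrable_add) auto
    have "t \<le> 1 + t\<^sup>2" for t :: real
      using zero_le_power2 [of "t - 1 / 2"] by (simp add: power2_eq_square algebra_simps)
    then show "AE x in circ. norm (u x) \<le> norm (1 + (norm (u x))\<^sup>2)"
      by (intro AE_I2) (auto intro: order_trans)
  qed
qed

lemma L2_circleI:
  assumes "\<And>x. u (x + 2 * pi) = u x" "u \<in> borel_measurable lebesgue"
    "integrable circ (\<lambda>x. (norm (u x))\<^sup>2)"
  shows "u \<in> L2_circle"
  using assms by (simp add: L2_circle_def set_integrable_circ)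

lemma L2_circle_add:
  assumes "u \<in> L2_circle" "v \<in> L2_circle"
  shows "(\<lambda>x. u x + v x) \<in> L2_circle"
proof (rule L2_circleI)
  note u = L2_circleD [OF assms(1)] and v = L2_circleD [OF assms(2)]
  show "u (x + 2 * pi) + v (x + 2 * pi) = u x + v x" for x
    using u v by simp
  show "(\<lambda>x. u x + v x) \<in> borel_measurable lebesgue"
    using u v by (intro borel_measurable_add)
  show "integrable circ (\<lambda>x. (norm (u x + v x))\<^sup>2)"
  proof (rule Bochner_Integration.integrable_bound)
    show "integrable circ (\<lambda>x. 2 * (norm (u x))\<^sup>2 + 2 * (norm (v x))\<^sup>2)"
      using u v by (intro Bochner_Integration.integrable_add integrable_mult_right)
    show "(\<lambda>x. (norm (u x + v x))\<^sup>2) \<in> borel_measurable circ"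
      using u(3) v(3) by measurable
    have "(norm (a + b))\<^sup>2 \<le> 2 * (norm a)\<^sup>2 + 2 * (norm b)\<^sup>2" for a b :: complex
    proof -
      have "(norm (a + b))\<^sup>2 \<le> (norm a + norm b)\<^sup>2"
        by (intro power_mono norm_triangle_ineq) auto
      also have "\<dots> \<le> 2 * (norm a)\<^sup>2 + 2 * (norm b)\<^sup>2"
        using zero_le_power2 [of "norm a - norm b"] by (simp add: power2_eq_square algebra_simps)
      finally show ?thesis .
    qed
    then show "AE x in circ. norm ((norm (u x + v x))\<^sup>2) \<le> norm (2 * (norm (u x))\<^sup>2 + 2 * (norm (v x))\<^sup>2)"
      by (intro AE_I2) auto
  qed
qed

lemma L2_circle_cmult:
  assumes "u \<in> L2_circle"
  shows "(\<lambda>x. a * u x) \<in> L2_circle"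
  by (rule L2_circleI) (use L2_circleD [OF assms] in \<open>auto simp: norm_mult power_mult_distrib\<close>)

lemma L2_circleI_bounded:
  assumes "\<And>x. u (x + 2 * pi) = u x" "u \<in> borel_measurable lebesgue"
    "AE x in circ. norm (u x) \<le> B"
  shows "u \<in> L2_circle"
proof (rule L2_circleI [OF assms(1,2)])
  have "u \<in> borel_measurable circ"
    using assms(2) by (intro measurable_restrict_space1)
  then have "(\<lambda>x. (norm (u x))\<^sup>2) \<in> borel_measurable circ" by measurable
  then show "integrable circ (\<lambda>x. (norm (u x))\<^sup>2)"
    by (rule Bochner_Integration.integrable_bound [OF integrable_circ_const [of "B\<^sup>2"]])
       (use assms(3) in \<open>auto elim!: eventually_mono intro: power_mono\<close>)
qed

lemma L2_circle_const: "(\<lambda>x. a) \<in> L2_circle"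
  by (rule L2_circleI_bounded [where B = "norm a"]) auto

lemma fourier_series_L2_circle:
  assumes c: "(\<lambda>k. norm (c k)) summable_on UNIV"
  shows "fourier_series c \<in> L2_circle"
  by (rule L2_circleI_bounded [where B = "\<Sum>\<^sub>\<infinity>k\<in>UNIV. norm (c k)"])
     (use continuous_imp_measurable_on_sets_lebesgue [OF continuous_on_fourier_series [OF c], of UNIV]
        norm_fourier_series_le [OF c] in \<open>auto simp: fourier_series_periodic\<close>)

section \<open>Sobolev balls in terms of coefficients\<close>

text \<open>All terms are nonnegative, so convergence with sum at most \<open>X\<^sup>2\<close>
  amounts to the same bound on finite partial sums. Norm estimates thereby become statements about
  coefficient sequences.\<close>

lemma sobolev_ball_iff:
  "u \<in> sobolev_ball m X \<longleftrightarrow> u \<in> L2_circle \<and> fourier_coeff u \<in> coeff_ball m X"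
proof -
  define f where "f k = weight m k * (norm (fourier_coeff u k))\<^sup>2" for k
  have f0: "0 \<le> f k" for k by (simp add: f_def)
  have s0: "0 \<le> infsum f UNIV" by (simp add: infsum_nonneg f0)
  have "f summable_on UNIV \<and> sqrt (infsum f UNIV) \<le> X \<longleftrightarrow> 0 \<le> X \<and> (\<forall>F. finite F \<longrightarrow> sum f F \<le> X\<^sup>2)"
    (is "?l \<longleftrightarrow> ?r")
  proof
    assume l: ?l
    then have X: "0 \<le> X" using s0 real_sqrt_ge_zero order_trans by blast
    have "sum f F \<le> X\<^sup>2" if "finite F" for F
    proof -
      have "sum f F \<le> infsum f UNIV"
        using l that f0 by (intro finite_sum_le_infsum) auto
      also have "\<dots> \<le> X\<^sup>2" using l X s0 by (simp add: sqrt_le_D)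
      finally show ?thesis .
    qed
    with X show ?r by blast
  next
    assume r: ?r
    have s: "f summable_on UNIV"
      by (rule nonneg_bdd_above_summable_on) (use r f0 in \<open>auto intro!: bdd_aboveI2\<close>)
    have "infsum f UNIV \<le> X\<^sup>2"
      by (rule infsum_le_finite_sums [OF s]) (use r in auto)
    with r s show ?l by (auto intro: real_le_lsqrt)
  qed
  then show ?thesis
    unfolding coeff_ball_iff f_def weight_def
    by (auto simp: sobolev_ball_def sobolev_def sobolev_norm_def)
qed

lemma sobolev_ball_nonneg: "u \<in> sobolev_ball m X \<Longrightarrow> 0 \<le> X"
  using coeff_ball_nonneg by (auto simp: sobolev_ball_iff)

lemma sobolev_ball_mono: "u \<in> sobolev_ball m X \<Longrightarrow> X \<le> Y \<Longrightarrow> u \<in> sobolev_ball m Y"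
  by (auto simp: sobolev_ball_def)

lemma sobolev_ball_add:
  assumes "u \<in> sobolev_ball m X" "v \<in> sobolev_ball m Y"
  shows "(\<lambda>x. u x + v x) \<in> sobolev_ball m (X + Y)"
proof -
  have "fourier_coeff (\<lambda>x. u x + v x) = (\<lambda>k. fourier_coeff u k + fourier_coeff v k)"
    using assms by (intro ext fourier_coeff_add) (auto simp: sobolev_ball_iff intro: L2_circleD)
  then show ?thesis
    using assms by (simp add: sobolev_ball_iff L2_circle_add coeff_ball_add)
qed

lemma sobolev_ball_diff:
  assumes u: "u \<in> sobolev_ball m X" and v: "v \<in> sobolev_ball m Y"
  shows "(\<lambda>x. u x - v x) \<in> sobolev_ball m (X + Y)"
proof -
  have "(\<lambda>k. - 1 * fourier_coeff v k) \<in> coeff_ball m (1 * Y)"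
    using v by (intro coeff_ball_mult) (auto simp: sobolev_ball_iff)
  moreover have "fourier_coeff (\<lambda>x. - 1 * v x) = (\<lambda>k. - 1 * fourier_coeff v k)"
    by (intro ext fourier_coeff_cmult)
  ultimately have "(\<lambda>x. - 1 * v x) \<in> sobolev_ball m Y"
    using v L2_circle_cmult [of v "- 1"] unfolding sobolev_ball_iff by simp
  from sobolev_ball_add [OF u this] show ?thesis by simp
qed

lemma sobolev_ball_const: "(\<lambda>x. a) \<in> sobolev_ball m (norm a)"
proof -
  have fc: "fourier_coeff (\<lambda>x. a) k = (if k = 0 then a else 0)" for k
    using fourier_coeff_cmult [of a "\<lambda>x. 1" k] by (simp add: fourier_coeff_one)
  have "fourier_coeff (\<lambda>x. a) \<in> coeff_ball m (norm a)"
  proof (rule coeff_ballI)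
    fix F :: "int set" assume "finite F"
    have "L2_set (\<lambda>k. weight (m / 2) k * norm (fourier_coeff (\<lambda>x. a) k)) F
        \<le> (\<Sum>k\<in>F. weight (m / 2) k * norm (fourier_coeff (\<lambda>x. a) k))"
      by (rule L2_set_le_sum) simp
    also have "\<dots> = (\<Sum>k\<in>F. if k = 0 then norm a else 0)"
      by (intro sum.cong refl) (simp add: fc weight_def)
    also have "\<dots> \<le> norm a" using \<open>finite F\<close> by simp
    finally show "L2_set (\<lambda>k. weight (m / 2) k * norm (fourier_coeff (\<lambda>x. a) k)) F \<le> norm a" .
  qed
  then show ?thesis by (simp add: sobolev_ball_iff L2_circle_const)
qed

lemma sobolev_ball_abs_summable:
  assumes "m > 1 / 2" "u \<in> sobolev_ball m X"
  shows "(\<lambda>k. norm (fourier_coeff u k)) summable_on UNIV"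
  using assms by (auto simp: sobolev_ball_iff intro: coeff_ball_abs_summable)

text \<open>The function and the sum of its absolutely convergent series have the same coefficients,
  so the uniqueness theorem applies to their difference.\<close>

lemma sobolev_ball_AE_series:
  assumes m: "m > 1 / 2" and u: "u \<in> sobolev_ball m X"
  shows "AE x in circ. u x = fourier_series (fourier_coeff u) x"
proof -
  note s = sobolev_ball_abs_summable [OF m u]
  have i: "integrable circ u" "integrable circ (fourier_series (fourier_coeff u))"
    using u s by (auto simp: sobolev_ball_iff fourier_series_L2_circle intro: L2_circleD)
  have "AE x in circ. u x - fourier_series (fourier_coeff u) x = 0"
    by (rule vanishing_coeffs_AE_0)
       (use i in \<open>auto simp: fourier_coeff_diff fourier_coeff_series [OF s]\<close>)
  then show ?thesis by eventually_elim simp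
qed

definition algebra_const :: "real \<Rightarrow> real" where
  "algebra_const m = sqrt (2 * 4 powr m * weight_const m)"

lemma algebra_const_nonneg [simp]: "0 \<le> algebra_const m"
  by (simp add: algebra_const_def)

text \<open>Replacing \<open>u\<close> by its series changes the product only on a null set, and
  then the coefficients of the product are a convolution. Square integrability holds because both
  factors are bounded almost everywhere by the absolute sums of their coefficients.\<close>

lemma sobolev_ball_times:
  assumes m: "m > 1 / 2" and u: "u \<in> sobolev_ball m X" and v: "v \<in> sobolev_ball m Y"
  shows "(\<lambda>x. u x * v x) \<in> sobolev_ball m (algebra_const m * (X * Y))"
  unfolding sobolev_ball_iff
proof
  let ?U = "fourier_series (fourier_coeff u)" and ?V = "fourier_series (fourier_coeff v)"
  note su = sobolev_ball_abs_summable [OF m u] and sv = sobolev_ball_abs_summable [OF m v]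
  note au = sobolev_ball_AE_series [OF m u] and av = sobolev_ball_AE_series [OF m v]
  have u2: "u \<in> L2_circle" and v2: "v \<in> L2_circle"
    using u v by (auto simp: sobolev_ball_iff)
  note ud = L2_circleD [OF u2] and vd = L2_circleD [OF v2]
  show "(\<lambda>x. u x * v x) \<in> L2_circle"
  proof (rule L2_circleI_bounded)
    show "u (x + 2 * pi) * v (x + 2 * pi) = u x * v x" for x
      using ud vd by simp
    show "(\<lambda>x. u x * v x) \<in> borel_measurable lebesgue"
      using ud vd by (intro borel_measurable_times)
    show "AE x in circ. norm (u x * v x)
        \<le> (\<Sum>\<^sub>\<infinity>k\<in>UNIV. norm (fourier_coeff u k)) * (\<Sum>\<^sub>\<infinity>k\<in>UNIV. norm (fourier_coeff v k))"
      using au av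
    proof eventually_elim
      case (elim x)
      then have "norm (u x * v x) = norm (?U x) * norm (?V x)"
        by (simp add: norm_mult)
      also have "\<dots> \<le> (\<Sum>\<^sub>\<infinity>k\<in>UNIV. norm (fourier_coeff u k)) * (\<Sum>\<^sub>\<infinity>k\<in>UNIV. norm (fourier_coeff v k))"
        by (intro mult_mono norm_fourier_series_le su sv infsum_nonneg) auto
      finally show ?case .
    qed
  qed
  have "fourier_coeff (\<lambda>x. u x * v x) = fourier_coeff (\<lambda>x. ?U x * v x)"
  proof (rule ext, rule fourier_coeff_cong_AE)
    show "(\<lambda>x. u x * v x) \<in> borel_measurable circ"
      using ud vd by (intro borel_measurable_times)
    show "(\<lambda>x. ?U x * v x) \<in> borel_measurable circ"
      using vd(3) L2_circleD(3) [OF fourier_series_L2_circle [OF su]] by (intro borel_measurable_times)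
    show "AE x in circ. u x * v x = ?U x * v x"
      using au by eventually_elim simp
  qed
  moreover have "fourier_coeff (\<lambda>x. ?U x * v x) \<in> coeff_ball m (algebra_const m * (X * Y))"
    unfolding algebra_const_def
    by (rule coeff_ball_convolution [OF m _ _ fourier_coeff_mult_series [OF vd(5) su]])
       (use u v in \<open>auto simp: sobolev_ball_iff\<close>)
  ultimately show "fourier_coeff (\<lambda>x. u x * v x) \<in> coeff_ball m (algebra_const m * (X * Y))"
    by simp
qed

section \<open>Multipliers and polynomial maps on Sobolev balls\<close>

text \<open>A bounded symbol keeps the coefficients in a weighted ball, so their Fourier series is a
  witness for the choice in \<open>fourier_multiplier\<close>. Any chosen function has the same
  coefficients, which alone determine the norm.\<close>

lemma fourier_multiplier_sobolev_ball:
  assumes m: "m > 1 / 2" and u: "u \<in> sobolev_ball m X" and e: "0 \<le> e" "\<And>k. norm (\<sigma> k) \<le> e"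
  shows "fourier_multiplier \<sigma> u \<in> sobolev_ball m (e * X)"
    and "fourier_coeff (fourier_multiplier \<sigma> u) k = \<sigma> k * fourier_coeff u k"
proof -
  have b: "(\<lambda>k. \<sigma> k * fourier_coeff u k) \<in> coeff_ball m (e * X)"
    using u e by (intro coeff_ball_mult) (auto simp: sobolev_ball_iff)
  note s = coeff_ball_abs_summable [OF b m]
  have "\<exists>v. v \<in> L2_circle \<and> (\<forall>k. fourier_coeff v k = \<sigma> k * fourier_coeff u k)"
    using fourier_series_L2_circle [OF s] fourier_coeff_series [OF s] by blast
  then have f: "fourier_multiplier \<sigma> u \<in> L2_circle \<and>
      (\<forall>k. fourier_coeff (fourier_multiplier \<sigma> u) k = \<sigma> k * fourier_coeff u k)"
    unfolding fourier_multiplier_def by (rule someI_ex)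
  then show "fourier_coeff (fourier_multiplier \<sigma> u) k = \<sigma> k * fourier_coeff u k" by blast
  have "fourier_coeff (fourier_multiplier \<sigma> u) = (\<lambda>k. \<sigma> k * fourier_coeff u k)"
    using f by blast
  with f b show "fourier_multiplier \<sigma> u \<in> sobolev_ball m (e * X)"
    by (simp add: sobolev_ball_iff)
qed

text \<open>Induction along Horner's scheme with the algebra property. The difference is measured by
  an arbitrary radius \<open>\<delta>\<close>, so the claim is stated by ball membership
  alone.\<close>

lemma poly_sobolev_lipschitz:
  assumes m: "m > 1 / 2" and R: "0 \<le> R"
  obtains K where "0 \<le> K" "\<And>w. w \<in> sobolev_ball m R \<Longrightarrow> (\<lambda>x. poly p (w x)) \<in> sobolev_ball m K"
    "\<And>w1 w2 \<delta>. \<lbrakk>w1 \<in> sobolev_ball m R; w2 \<in> sobolev_ball m R; (\<lambda>x. w1 x - w2 x) \<in> sobolev_ball m \<delta>\<rbrakk>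
      \<Longrightarrow> (\<lambda>x. poly p (w1 x) - poly p (w2 x)) \<in> sobolev_ball m (K * \<delta>)"
proof (induction p arbitrary: thesis)
  case 0
  have "(\<lambda>x. 0) \<in> sobolev_ball m 0"
    using sobolev_ball_const [of 0 m] by simp
  then show ?case by (intro 0 [of 0]) auto
next
  case (pCons a p)
  obtain K where K: "0 \<le> K"
    "\<And>w. w \<in> sobolev_ball m R \<Longrightarrow> (\<lambda>x. poly p (w x)) \<in> sobolev_ball m K"
    "\<And>w1 w2 \<delta>. \<lbrakk>w1 \<in> sobolev_ball m R; w2 \<in> sobolev_ball m R; (\<lambda>x. w1 x - w2 x) \<in> sobolev_ball m \<delta>\<rbrakk>
      \<Longrightarrow> (\<lambda>x. poly p (w1 x) - poly p (w2 x)) \<in> sobolev_ball m (K * \<delta>)"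
    using pCons.IH by blast
  define A where "A = algebra_const m"
  have A: "0 \<le> A" by (simp add: A_def)
  \<comment> \<open>The first two terms bound the size of the new polynomial, the last two its
    Lipschitz constant; one number serves for both.\<close>
  define K' where "K' = norm a + A * (R * K) + A * K"
  show ?case
  proof (rule pCons.prems)
    show "0 \<le> K'" using A R K by (simp add: K'_def)
    show "(\<lambda>x. poly (pCons a p) (w x)) \<in> sobolev_ball m K'" if w: "w \<in> sobolev_ball m R" for w
    proof (rule sobolev_ball_mono)
      show "(\<lambda>x. poly (pCons a p) (w x)) \<in> sobolev_ball m (norm a + A * (R * K))"
        using sobolev_ball_add [OF sobolev_ball_const sobolev_ball_times [OF m w K(2) [OF w]]]
        by (simp add: A_def)
      show "norm a + A * (R * K) \<le> K'" using A K by (simp add: K'_def)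
    qed
    show "(\<lambda>x. poly (pCons a p) (w1 x) - poly (pCons a p) (w2 x)) \<in> sobolev_ball m (K' * \<delta>)"
      if w: "w1 \<in> sobolev_ball m R" "w2 \<in> sobolev_ball m R" "(\<lambda>x. w1 x - w2 x) \<in> sobolev_ball m \<delta>"
      for w1 w2 \<delta>
    proof (rule sobolev_ball_mono)
      \<comment> \<open>The product-rule splitting of w1 p(w1) - w2 p(w2); the constant
        \<open>a\<close> cancels.\<close>
      have "(\<lambda>x. (w1 x - w2 x) * poly p (w1 x) + w2 x * (poly p (w1 x) - poly p (w2 x)))
          \<in> sobolev_ball m (A * (\<delta> * K) + A * (R * (K * \<delta>)))"
        unfolding A_def using w by (intro sobolev_ball_add sobolev_ball_times m K)
      then show "(\<lambda>x. poly (pCons a p) (w1 x) - poly (pCons a p) (w2 x))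
          \<in> sobolev_ball m (A * (\<delta> * K) + A * (R * (K * \<delta>)))"
        by (simp add: algebra_simps)
      show "A * (\<delta> * K) + A * (R * (K * \<delta>)) \<le> K' * \<delta>"
        using sobolev_ball_nonneg [OF w(3)] by (simp add: K'_def algebra_simps)
    qed
  qed
qed

section \<open>Invariance of the ball and contraction\<close>

theorem mainTheorem1:
  fixes m :: real and l :: nat and L M G :: "complex poly"
  assumes "m > 1 / 2"
    and "degree L = l"
    and "M = 0 \<or> degree M < l"
    and "\<forall>k::real. Re (poly L (\<i> * of_real k)) = 0"
    and "poly G 0 = 0"
  shows "\<forall>R::real. R > 0 \<longrightarrow>
    (\<exists>r T K :: real. r > 0 \<and> T > 0 \<and> K < 1 \<and>
      (\<forall>u \<in> sobolev_ball m r. \<forall>\<Delta>t::real. 0 < \<Delta>t \<and> \<Delta>t < T \<longrightarrow>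
        H_map L M G \<Delta>t u ` sobolev_ball m R \<subseteq> sobolev_ball m R \<and>
        (\<forall>w1 \<in> sobolev_ball m R. \<forall>w2 \<in> sobolev_ball m R.
          sobolev_norm m (\<lambda>x. H_map L M G \<Delta>t u w1 x - H_map L M G \<Delta>t u w2 x)
            \<le> K * sobolev_norm m (\<lambda>x. w1 x - w2 x))))"
proof (intro allI impI)
  note m = assms(1) and skew = assms(4)
  have deg: "M = 0 \<or> degree M < degree L" using assms(2,3) by simp
  fix R :: real assume R: "R > 0"
  obtain K where K: "0 \<le> K"
    "\<And>w. w \<in> sobolev_ball m R \<Longrightarrow> (\<lambda>x. poly G (w x)) \<in> sobolev_ball m K"
    "\<And>w1 w2 \<delta>. \<lbrakk>w1 \<in> sobolev_ball m R; w2 \<in> sobolev_ball m R; (\<lambda>x. w1 x - w2 x) \<in> sobolev_ball m \<delta>\<rbrakk>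
      \<Longrightarrow> (\<lambda>x. poly G (w1 x) - poly G (w2 x)) \<in> sobolev_ball m (K * \<delta>)"
    using poly_sobolev_lipschitz [OF m, of R G] R by auto
  \<comment> \<open>The first bound gives \<open>e * (K + K) \<le> R / 2\<close> for invariance of
    the ball, the second \<open>e * K \<le> 1 / 2\<close> for the contraction; the added 1 covers
    \<open>K = 0\<close>.\<close>
  define e where "e = min (R / (4 * (K + 1))) (1 / (2 * (K + 1)))"
  have e: "e > 0" using R K by (simp add: e_def)
  have eK: "e * (K + K) \<le> R / 2" "e * K \<le> 1 / 2"
  proof -
    have "e * (4 * (K + 1)) \<le> R" "e * (2 * (K + 1)) \<le> 1"
      using K by (simp_all add: e_def flip: pos_le_divide_eq)
    then show "e * (K + K) \<le> R / 2" "e * K \<le> 1 / 2"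
      using e by (simp_all add: algebra_simps)
  qed
  from implicit_symbol_small [OF deg skew e]
  obtain T where T: "T > 0" "\<forall>\<Delta>t k. 0 < \<Delta>t \<longrightarrow> \<Delta>t < T \<longrightarrow>
    norm (complex_of_real (\<Delta>t / 2) * poly M (\<i> * of_int k)
      / (1 - complex_of_real (\<Delta>t / 2) * poly L (\<i> * of_int k))) \<le> e"
    by blast
  have main: "H_map L M G \<Delta>t u ` sobolev_ball m R \<subseteq> sobolev_ball m R \<and>
      (\<forall>w1 \<in> sobolev_ball m R. \<forall>w2 \<in> sobolev_ball m R.
        sobolev_norm m (\<lambda>x. H_map L M G \<Delta>t u w1 x - H_map L M G \<Delta>t u w2 x)
          \<le> 1 / 2 * sobolev_norm m (\<lambda>x. w1 x - w2 x))"
    if u: "u \<in> sobolev_ball m (R / 2)" and t: "0 < \<Delta>t" "\<Delta>t < T" for u \<Delta>t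
  proof (intro conjI ballI)
    define b where "b k = complex_of_real (\<Delta>t / 2) * poly M (\<i> * of_int k)
      / (1 - complex_of_real (\<Delta>t / 2) * poly L (\<i> * of_int k))" for k :: int
    have be: "norm (b k) \<le> e" for k unfolding b_def using T(2) t by blast
    have B: "B_op L M \<Delta>t = fourier_multiplier b"
      by (simp only: B_op_def Let_def b_def [abs_def])
    have C: "C_op L \<Delta>t u \<in> sobolev_ball m (R / 2)"
    proof -
      have "C_op L \<Delta>t u \<in> sobolev_ball m (1 * (R / 2))"
        unfolding C_op_def Let_def
        by (rule fourier_multiplier_sobolev_ball(1) [OF m u]) (simp_all only: cayley_symbol_norm [OF skew] zero_le_one order_refl)
      then show ?thesis by simp
    qed
    have uR: "u \<in> sobolev_ball m R"
      using sobolev_ball_mono [OF u] R by simp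
    have Guw: "(\<lambda>x. poly G (u x) + poly G (w x)) \<in> sobolev_ball m (K + K)"
      if "w \<in> sobolev_ball m R" for w
      using that uR by (intro sobolev_ball_add K)
    note Bw = fourier_multiplier_sobolev_ball [OF m Guw less_imp_le [OF e] be]
    show "H_map L M G \<Delta>t u ` sobolev_ball m R \<subseteq> sobolev_ball m R"
    proof (rule image_subsetI)
      fix w assume w: "w \<in> sobolev_ball m R"
      have "H_map L M G \<Delta>t u w \<in> sobolev_ball m (R / 2 + e * (K + K))"
        unfolding H_map_def B using C Bw(1) [OF w] by (rule sobolev_ball_add)
      then show "H_map L M G \<Delta>t u w \<in> sobolev_ball m R"
        by (rule sobolev_ball_mono) (use eK in simp)
    qed
    fix w1 w2 assume w: "w1 \<in> sobolev_ball m R" "w2 \<in> sobolev_ball m R"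
    define \<delta> where "\<delta> = sobolev_norm m (\<lambda>x. w1 x - w2 x)"
    \<comment> \<open>Membership in a ball of radius \<open>R + R\<close> shows that the norm is a
      genuine sum; the difference then lies in the ball whose radius is its own norm.\<close>
    have d: "(\<lambda>x. w1 x - w2 x) \<in> sobolev_ball m \<delta>"
      using sobolev_ball_diff [OF w] by (simp add: sobolev_ball_def \<delta>_def)
    define D where "D = (\<lambda>x. H_map L M G \<Delta>t u w1 x - H_map L M G \<Delta>t u w2 x)"
    have D: "D = (\<lambda>x. fourier_multiplier b (\<lambda>x. poly G (u x) + poly G (w1 x)) x
        - fourier_multiplier b (\<lambda>x. poly G (u x) + poly G (w2 x)) x)"
      by (simp add: D_def H_map_def B)
    have D2: "D \<in> L2_circle"
      using sobolev_ball_diff [OF Bw(1) [OF w(1)] Bw(1) [OF w(2)]] by (simp add: D sobolev_ball_iff)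
    \<comment> \<open>The representatives chosen by \<open>fourier_multiplier\<close> need not be
      additive as functions, so linearity is used for coefficients only, where the contributions of
      \<open>u\<close> cancel.\<close>
    have i: "integrable circ f" if "f \<in> sobolev_ball m X" for f X
      using that by (auto simp: sobolev_ball_iff intro: L2_circleD)
    have "fourier_coeff D k = b k * fourier_coeff (\<lambda>x. poly G (w1 x) - poly G (w2 x)) k" for k
    proof -
      have "fourier_coeff D k = b k * (fourier_coeff (\<lambda>x. poly G (u x) + poly G (w1 x)) k
          - fourier_coeff (\<lambda>x. poly G (u x) + poly G (w2 x)) k)"
        unfolding D fourier_coeff_diff [OF i [OF Bw(1) [OF w(1)]] i [OF Bw(1) [OF w(2)]]]
          Bw(2) [OF w(1)] Bw(2) [OF w(2)] right_diff_distrib ..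
      then show ?thesis
        by (simp add: fourier_coeff_add fourier_coeff_diff
            i [OF K(2) [OF uR]] i [OF K(2) [OF w(1)]] i [OF K(2) [OF w(2)]])
    qed
    then have "fourier_coeff D = (\<lambda>k. b k * fourier_coeff (\<lambda>x. poly G (w1 x) - poly G (w2 x)) k)"
      by blast
    moreover have "\<dots> \<in> coeff_ball m (e * (K * \<delta>))"
      using K(3) [OF w d] e be by (intro coeff_ball_mult) (auto simp: sobolev_ball_iff)
    ultimately have "D \<in> sobolev_ball m (e * (K * \<delta>))"
      using D2 by (simp add: sobolev_ball_iff)
    then have "sobolev_norm m D \<le> e * K * \<delta>"
      by (simp add: sobolev_ball_def)
    also have "\<dots> \<le> 1 / 2 * \<delta>"
      using eK sobolev_ball_nonneg [OF d] by (intro mult_right_mono)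
    finally show "sobolev_norm m (\<lambda>x. H_map L M G \<Delta>t u w1 x - H_map L M G \<Delta>t u w2 x)
        \<le> 1 / 2 * sobolev_norm m (\<lambda>x. w1 x - w2 x)"
      by (simp add: D_def \<delta>_def)
  qed
  show "\<exists>r T K :: real. r > 0 \<and> T > 0 \<and> K < 1 \<and>
      (\<forall>u \<in> sobolev_ball m r. \<forall>\<Delta>t::real. 0 < \<Delta>t \<and> \<Delta>t < T \<longrightarrow>
        H_map L M G \<Delta>t u ` sobolev_ball m R \<subseteq> sobolev_ball m R \<and>
        (\<forall>w1 \<in> sobolev_ball m R. \<forall>w2 \<in> sobolev_ball m R.
          sobolev_norm m (\<lambda>x. H_map L M G \<Delta>t u w1 x - H_map L M G \<Delta>t u w2 x)
            \<le> K * sobolev_norm m (\<lambda>x. w1 x - w2 x)))"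
  \<comment> \<open>With \<open>u\<close> in the ball of radius \<open>R / 2\<close>, the term with
    \<open>C_op\<close> uses half of the radius and leaves the other half to the term with
    \<open>B_op\<close>.\<close>
  proof (rule exI [of _ "R / 2"], rule exI [of _ T], rule exI [of _ "1 / 2"], intro conjI ballI)
    show "\<forall>\<Delta>t. 0 < \<Delta>t \<and> \<Delta>t < T \<longrightarrow>
        H_map L M G \<Delta>t u ` sobolev_ball m R \<subseteq> sobolev_ball m R \<and>
        (\<forall>w1 \<in> sobolev_ball m R. \<forall>w2 \<in> sobolev_ball m R.
          sobolev_norm m (\<lambda>x. H_map L M G \<Delta>t u w1 x - H_map L M G \<Delta>t u w2 x)
            \<le> 1 / 2 * sobolev_norm m (\<lambda>x. w1 x - w2 x))" if "u \<in> sobolev_ball m (R / 2)" for u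
      using main [OF that] by blast
  qed (use R T(1) in simp_all)
qed

end
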